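(* Let $\mathcal{P}$ be either $\mathcal{G}$ or $\mathcal{M}$ and let $X_\lambda$ be a cellular $\mathcal{P}$-multipointed $d$-space with set of states $X^0$. Let $(\alpha,\beta)\in X^0\times X^0$. Let $\psi:[0,1]\to\mathbb{P}^{top}_{\alpha,\beta}X_\lambda$ be a continuous map. Then the set of natural lengths of $\psi(u)$ for $u$ running over $[0,1]$ is bounded.
   Context: $\mathbf{Top}$ denotes either the category of $\Delta$-generated spaces (spaces whose topology is final with respect to all continuous maps from $[0,1]$) or its full subcategory of $\Delta$-Hausdorff ones (the image of every continuous map from $[0,1]$ is closed). The $\Delta$-kelleyfication of a space is the same set with the final topology with respect to all continuous maps from $[0,1]$; $\mathbf{TOP}(U,V)$ is the set of continuous maps with the $\Delta$-kelleyfication of the compact-open topology. $\mathcal{G}(1,1)$ (resp. $\mathcal{M}(1,1)$) is the set of nondecreasing homeomorphisms (resp. nondecreasing surjective maps) from $[0,1]$ to itself. Let $\mathcal{P}$ be $\mathcal{G}$ or $\mathcal{M}$. Let $\mu_\ell:[0,\ell]\to[0,1]$, $\mu_\ell(t)=t/\ell$. The Moore composition of $\gamma_1:[0,\ell_1]\to U$ and $\gamma_2:[0,\ell_2]\to U$ with $\gamma_1(\ell_1)=\gamma_2(0)$ is $\gamma_1*\gamma_2:[0,\ell_1+\ell_2]\to U$ equal to $\gamma_1(t)$ on $[0,\ell_1]$ and $\gamma_2(t-\ell_1)$ on $[\ell_1,\ell_1+\ell_2]$. A $\mathcal{P}$-multipointed $d$-space is a triple $X=(|X|,X^0,\mathbb{P}^{top}X)$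 with $|X|\in\mathbf{Top}$, $X^0\subset |X|$ a set (of states), and $\mathbb{P}^{top}X$ a set of continuous maps $[0,1]\to|X|$ (execution paths) such that: $\gamma(0),\gamma(1)\in X^0$ for each execution path; $\gamma\phi$ is an execution path for each execution path $\gamma$ and each $\phi\in\mathcal{P}(1,1)$; and if $\gamma_1(1)=\gamma_2(0)$ the normalized composition ($t\mapsto\gamma_1(2t)$ for $t\le 1/2$, $t\mapsto\gamma_2(2t-1)$ for $t\geq 1/2$) is an execution path. Maps are continuous maps $|X|\to|Y|$ sending states to states and execution paths to execution paths. $\mathbb{P}^{top}_{\alpha,\beta}X$ is the set of execution paths from $\alpha$ to $\beta$ with the $\Delta$-kelleyfication of the relative topology from $\mathbf{TOP}([0,1],|X|)$. For $Z\in\mathbf{Top}$, $\mathrm{Glob}^{\mathcal{P}}(Z)$ is the $\mathcal{P}$-multipointed $d$-space with underlying space the quotient of $\{0,1\}\sqcup(Z\times[0,1])$ by $(z,0)=(z',0)=0$ and $(z,1)=(z',1)=1$, states $\{0,1\}$, and execution paths the maps $\delta_z\phi$ with $z\in Z$, $\phi\in\mathcal{P}(1,1)$, where $\delta_z(t)=(z,t)$. Cellular objects: let $\lambda$ be an ordinal and $(X_\nu)_{\nu\le\lambda}$ a colimit-preserving transfinite sequence of $\mathcal{P}$-multipointed $d$-spaces such that $X_0=(X^0,X^0,\varnothing)$ for a set $X^0$ (discrete) and, for each $\nu<\lambda$, $X_{\nu+1}$ is the pushout of $\mathrm{Glob}^{\mathcal{P}}(\mathbf{D}^{n_\nu})\leftarrow\mathrm{Glob}^{\mathcal{P}}(\mathbf{S}^{n_\nu-1})\xrightarrow{g_\nu}X_\nu$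 with $n_\nu\ge 0$ ($\mathbf{D}^n$ the unit disk, $\mathbf{S}^{n-1}$ its boundary sphere, $\mathbf{D}^0=\{0\}$, $\mathbf{S}^{-1}=\varnothing$); write $\widehat{g_\nu}:\mathrm{Glob}^{\mathcal{P}}(\mathbf{D}^{n_\nu})\to X_{\nu+1}\to X_\lambda$. Then $X_\lambda$ is called a cellular $\mathcal{P}$-multipointed $d$-space. Natural length: every execution path $\gamma$ of $X_\lambda$ can be written as a Moore composition $\gamma=(\widehat{g_{\nu_1}}\delta_{z_1}\phi_1\mu_{\ell_1})*\dots*(\widehat{g_{\nu_N}}\delta_{z_N}\phi_N\mu_{\ell_N})$ with $N\geq1$, $z_i\in\mathbf{D}^{n_{\nu_i}}\setminus\mathbf{S}^{n_{\nu_i}-1}$, $\phi_i\in\mathcal{P}(1,1)$, $\ell_i>0$, $\sum_i\ell_i=1$, where $N$, the $\nu_i$ and the $z_i$ are determined by $\gamma$. The integer $N$ is the natural length of $\gamma$. *)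

theory Defs
  imports "HOL-Analysis.Analysis"
begin

section \<open>Convenient topological spaces\<close>

abbreviation I01 :: "real topology" where
  "I01 \<equiv> top_of_set {0..1}"

definition final_topology :: "'a set \<Rightarrow> ('b topology \<times> ('b \<Rightarrow> 'a)) set \<Rightarrow> 'a topology" where
  "final_topology S F =
     topology (\<lambda>U. U \<subseteq> S \<and> (\<forall>(Y, f) \<in> F. openin Y {y \<in> topspace Y. f y \<in> U}))"

lemma openin_final_topology:
  "openin (final_topology S F) U \<longleftrightarrow>
     U \<subseteq> S \<and> (\<forall>(Y, f) \<in> F. openin Y {y \<in> topspace Y. f y \<in> U})"
proof -
  define L where "L U \<longleftrightarrow> U \<subseteq> S \<and> (\<forall>(Y, f) \<in> F. openin Y {y \<in> topspace Y. f y \<in> U})" for U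
  have LI: "L U" if "U \<subseteq> S" "\<And>Y f. (Y, f) \<in> F \<Longrightarrow> openin Y {y \<in> topspace Y. f y \<in> U}" for U
    using that unfolding L_def by fast
  have LD: "openin Y {y \<in> topspace Y. f y \<in> U}" if "L U" "(Y, f) \<in> F" for U Y f
    using that unfolding L_def by fast
  have LS: "U \<subseteq> S" if "L U" for U
    using that unfolding L_def by fast
  have "L (A \<inter> B)" if "L A" "L B" for A B
  proof (rule LI)
    show "A \<inter> B \<subseteq> S" using LS[OF \<open>L A\<close>] by fast
    fix Y f assume "(Y, f) \<in> F"
    note openin_Int[OF LD[OF \<open>L A\<close> this] LD[OF \<open>L B\<close> this]]
    moreover have "{y \<in> topspace Y. f y \<in> A} \<inter> {y \<in> topspace Y. f y \<in> B}
                   = {y \<in> topspace Y. f y \<in> A \<inter> B}"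
      by fast
    ultimately show "openin Y {y \<in> topspace Y. f y \<in> A \<inter> B}" by (rule back_subst)
  qed
  moreover have "L (\<Union>\<K>)" if "\<forall>K\<in>\<K>. L K" for \<K>
  proof (rule LI)
    show "\<Union>\<K> \<subseteq> S" using that LS by fast
    fix Y f assume "(Y, f) \<in> F"
    then have "openin Y (\<Union>K\<in>\<K>. {y \<in> topspace Y. f y \<in> K})"
      using that LD by (intro openin_Union) fast
    moreover have "(\<Union>K\<in>\<K>. {y \<in> topspace Y. f y \<in> K}) = {y \<in> topspace Y. f y \<in> \<Union>\<K>}"
      by fast
    ultimately show "openin Y {y \<in> topspace Y. f y \<in> \<Union>\<K>}" by (rule back_subst)
  qed
  ultimately have "istopology L"
    unfolding istopology_def by blast
  then have "openin (topology L) U \<longleftrightarrow> L U"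
    by (simp add: topology_inverse')
  moreover have "final_topology S F = topology L"
    unfolding final_topology_def L_def ..
  ultimately show ?thesis
    unfolding L_def by (simp only:)
qed

definition kelleyfication :: "'a topology \<Rightarrow> 'a topology" where
  "kelleyfication X = final_topology (topspace X) {(I01, c) | c. continuous_map I01 X c}"

lemma openin_kelleyfication:
  "openin (kelleyfication X) U \<longleftrightarrow>
     U \<subseteq> topspace X \<and>
     (\<forall>c. continuous_map I01 X c \<longrightarrow> openin I01 {t \<in> {0..1}. c t \<in> U})"
proof -
  have "(\<forall>(Y, f) \<in> {(I01, c) | c. continuous_map I01 X c}. Q Y f) \<longleftrightarrow>
        (\<forall>c. continuous_map I01 X c \<longrightarrow> Q I01 c)" for Q
    by blast
  then show ?thesis
    by (simp add: kelleyfication_def openin_final_topology)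
qed

lemma topspace_kelleyfication [simp]: "topspace (kelleyfication X) = topspace X"
proof -
  have "openin I01 {t \<in> {0..1}. c t \<in> topspace X}" if "continuous_map I01 X c" for c
    using openin_continuous_map_preimage [OF that openin_topspace] by simp
  then have "openin (kelleyfication X) (topspace X)"
    by (simp add: openin_kelleyfication)
  then have "topspace X \<subseteq> topspace (kelleyfication X)"
    by (rule openin_subset)
  moreover have "topspace (kelleyfication X) \<subseteq> topspace X"
    using openin_topspace [of "kelleyfication X"] by (simp only: openin_kelleyfication)
  ultimately show ?thesis
    by (simp only: set_eq_subset)
qed

datatype top_category = Delta_generated | Delta_Hausdorff

definition Top_space :: "top_category \<Rightarrow> 'a topology \<Rightarrow> bool" where
  "Top_space T X \<longleftrightarrow>
     kelleyfication X = X \<and>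
     (T = Delta_Hausdorff \<longrightarrow> (\<forall>c. continuous_map I01 X c \<longrightarrow> closedin X (c ` {0..1})))"

text \<open>Maps with a prescribed domain are represented by functions that are \<open>undefined\<close> outside
  of it, so that equality of maps is equality of functions.\<close>

definition cmaps :: "'a topology \<Rightarrow> 'b topology \<Rightarrow> ('a \<Rightarrow> 'b) set" where
  "cmaps U V = {f \<in> extensional (topspace U). continuous_map U V f}"

definition compact_open :: "'a topology \<Rightarrow> 'b topology \<Rightarrow> ('a \<Rightarrow> 'b) topology" where
  "compact_open U V =
     topology_generated_by {{f \<in> cmaps U V. f ` K \<subseteq> W} | K W. compactin U K \<and> openin V W}"

definition mapping_space :: "'a topology \<Rightarrow> 'b topology \<Rightarrow> ('a \<Rightarrow> 'b) topology" where
  "mapping_space U V = kelleyfication (compact_open U V)"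


section \<open>Multipointed d-spaces\<close>

definition reparam_G :: "(real \<Rightarrow> real) set" where
  "reparam_G = {\<phi> \<in> extensional {0..1}. mono_on {0..1} \<phi> \<and> homeomorphic_map I01 I01 \<phi>}"

definition reparam_M :: "(real \<Rightarrow> real) set" where
  "reparam_M = {\<phi> \<in> extensional {0..1}. mono_on {0..1} \<phi> \<and> \<phi> ` {0..1} = {0..1}}"

record 'a mdspace =
  carrier_space :: "'a topology"
  states :: "'a set"
  expaths :: "(real \<Rightarrow> 'a) set"

abbreviation points :: "'a mdspace \<Rightarrow> 'a set" where
  "points X \<equiv> topspace (carrier_space X)"

definition norm_comp :: "(real \<Rightarrow> 'a) \<Rightarrow> (real \<Rightarrow> 'a) \<Rightarrow> real \<Rightarrow> 'a" where
  "norm_comp \<gamma>1 \<gamma>2 = (\<lambda>t\<in>{0..1}. if t \<le> 1/2 then \<gamma>1 (2 * t) else \<gamma>2 (2 * t - 1))"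

definition is_mdspace :: "top_category \<Rightarrow> (real \<Rightarrow> real) set \<Rightarrow> 'a mdspace \<Rightarrow> bool" where
  "is_mdspace T P X \<longleftrightarrow>
     Top_space T (carrier_space X) \<and>
     states X \<subseteq> points X \<and>
     expaths X \<subseteq> cmaps I01 (carrier_space X) \<and>
     (\<forall>\<gamma>\<in>expaths X. \<gamma> 0 \<in> states X \<and> \<gamma> 1 \<in> states X) \<and>
     (\<forall>\<gamma>\<in>expaths X. \<forall>\<phi>\<in>P. compose {0..1} \<gamma> \<phi> \<in> expaths X) \<and>
     (\<forall>\<gamma>1\<in>expaths X. \<forall>\<gamma>2\<in>expaths X. \<gamma>1 1 = \<gamma>2 0 \<longrightarrow> norm_comp \<gamma>1 \<gamma>2 \<in> expaths X)"

definition md_hom :: "'a mdspace \<Rightarrow> 'b mdspace \<Rightarrow> ('a \<Rightarrow> 'b) set" where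
  "md_hom X Y =
     {h \<in> cmaps (carrier_space X) (carrier_space Y).
        h ` states X \<subseteq> states Y \<and> (\<forall>\<gamma>\<in>expaths X. compose {0..1} h \<gamma> \<in> expaths Y)}"

definition path_space :: "'a mdspace \<Rightarrow> 'a \<Rightarrow> 'a \<Rightarrow> (real \<Rightarrow> 'a) topology" where
  "path_space X \<alpha> \<beta> =
     kelleyfication
       (subtopology (mapping_space I01 (carrier_space X))
          {\<gamma> \<in> expaths X. \<gamma> 0 = \<alpha> \<and> \<gamma> 1 = \<beta>})"

definition discrete_mdspace :: "'a set \<Rightarrow> 'a mdspace" where
  "discrete_mdspace S = \<lparr>carrier_space = discrete_topology S, states = S, expaths = {}\<rparr>"


section \<open>Globes\<close>

text \<open>Points of the globe of \<open>Z\<close>: the states 0 and 1 (\<open>Bot\<close> and \<open>Top\<close>), and the classes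
  \<open>Mid z t\<close> of the pairs \<open>(z, t)\<close> with \<open>0 < t < 1\<close>, which are singletons. The function
  \<open>glob_pt\<close> is the quotient map. The product is the one of the convenient category.\<close>

datatype 'z glob = Bot | Top | Mid 'z real

definition glob_pt :: "'z \<times> real \<Rightarrow> 'z glob" where
  "glob_pt = (\<lambda>(z, t). if t = 0 then Bot else if t = 1 then Top else Mid z t)"

definition glob_space :: "'z topology \<Rightarrow> 'z glob topology" where
  "glob_space Z =
     final_topology ({Bot, Top} \<union> glob_pt ` (topspace Z \<times> {0..1}))
       {(kelleyfication (prod_topology Z I01), glob_pt)}"

lemma topspace_glob_space:
  "topspace (glob_space Z) = {Bot, Top} \<union> glob_pt ` (topspace Z \<times> {0..1})" (is "_ = ?S")
proof -
  let ?K = "kelleyfication (prod_topology Z I01)"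
  have "{y \<in> topspace ?K. glob_pt y \<in> ?S} = topspace ?K"
    by auto
  then have "openin ?K {y \<in> topspace ?K. glob_pt y \<in> ?S}"
    by (simp only: openin_topspace)
  then have "openin (glob_space Z) ?S"
    by (simp add: glob_space_def openin_final_topology)
  then have "?S \<subseteq> topspace (glob_space Z)"
    by (rule openin_subset)
  moreover have "topspace (glob_space Z) \<subseteq> ?S"
    using openin_topspace [of "glob_space Z"]
    by (simp only: glob_space_def openin_final_topology)
  ultimately show ?thesis
    by (simp only: set_eq_subset)
qed

definition glob_path :: "'z \<Rightarrow> real \<Rightarrow> 'z glob" where
  "glob_path z = (\<lambda>t\<in>{0..1}. glob_pt (z, t))"

definition Glob :: "(real \<Rightarrow> real) set \<Rightarrow> 'z topology \<Rightarrow> 'z glob mdspace" where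
  "Glob P Z =
     \<lparr>carrier_space = glob_space Z, states = {Bot, Top},
      expaths = {compose {0..1} (glob_path z) \<phi> | z \<phi>. z \<in> topspace Z \<and> \<phi> \<in> P}\<rparr>"

definition disk :: "nat \<Rightarrow> (nat \<Rightarrow> real) topology" where
  "disk n = subtopology (Euclidean_space n) {x. (\<Sum>i<n. (x i)\<^sup>2) \<le> 1}"

text \<open>The boundary of \<open>disk n\<close>, i.e. the sphere of dimension \<open>n - 1\<close>; empty if \<open>n = 0\<close>.\<close>

definition disk_boundary :: "nat \<Rightarrow> (nat \<Rightarrow> real) topology" where
  "disk_boundary n = subtopology (Euclidean_space n) {x. (\<Sum>i<n. (x i)\<^sup>2) = 1}"

definition glob_incl :: "nat \<Rightarrow> (nat \<Rightarrow> real) glob \<Rightarrow> (nat \<Rightarrow> real) glob" where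
  "glob_incl n = (\<lambda>x\<in>topspace (glob_space (disk_boundary n)). x)"


section \<open>Colimits\<close>

text \<open>HOL cannot quantify over all types inside a definition, so the universal properties are
  tested against the objects carried by an explicitly given type \<open>'t\<close>. Underlying maps
  of colimit cocones are jointly surjective. Hence, if both the coproduct of the sets of points of
  the diagram and the type of the vertex inject into \<open>'t\<close>, then \<open>'t\<close> carries a copy of the
  actual colimit and of the vertex, and the universal property for \<open>'t\<close> is equivalent to the one
  for all types.\<close>

definition is_pushout ::
  "'t itself \<Rightarrow> top_category \<Rightarrow> (real \<Rightarrow> real) set \<Rightarrow>
   'a mdspace \<Rightarrow> 'b mdspace \<Rightarrow> 'c mdspace \<Rightarrow> 'd mdspace \<Rightarrow>
   ('a \<Rightarrow> 'b) \<Rightarrow> ('a \<Rightarrow> 'c) \<Rightarrow> ('b \<Rightarrow> 'd) \<Rightarrow> ('c \<Rightarrow> 'd) \<Rightarrow> bool" where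
  "is_pushout _ T P A B C D i g k j \<longleftrightarrow>
     i \<in> md_hom A B \<and> g \<in> md_hom A C \<and> k \<in> md_hom B D \<and> j \<in> md_hom C D \<and>
     compose (points A) k i = compose (points A) j g \<and>
     (\<forall>E :: 't mdspace. is_mdspace T P E \<longrightarrow>
        (\<forall>u \<in> md_hom B E. \<forall>v \<in> md_hom C E.
           compose (points A) u i = compose (points A) v g \<longrightarrow>
           (\<exists>!w. w \<in> md_hom D E \<and>
                 compose (points B) w k = u \<and> compose (points C) w j = v)))"

text \<open>\<open>is_seq_colimit _ T P X f \<nu>\<close>: the object \<open>X \<nu>\<close> with the maps
  \<open>f \<mu> \<nu> : X \<mu> \<rightarrow> X \<nu>\<close> is the colimit of the diagram \<open>(X \<mu>)\<close>, \<open>\<mu> < \<nu>\<close>.\<close>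

definition is_seq_colimit ::
  "'t itself \<Rightarrow> top_category \<Rightarrow> (real \<Rightarrow> real) set \<Rightarrow>
   ('i::wellorder \<Rightarrow> 'a mdspace) \<Rightarrow> ('i \<Rightarrow> 'i \<Rightarrow> 'a \<Rightarrow> 'a) \<Rightarrow> 'i \<Rightarrow> bool" where
  "is_seq_colimit _ T P X f \<nu> \<longleftrightarrow>
     (\<forall>E :: 't mdspace. is_mdspace T P E \<longrightarrow>
        (\<forall>u. (\<forall>\<mu><\<nu>. u \<mu> \<in> md_hom (X \<mu>) E) \<longrightarrow>
             (\<forall>\<rho><\<nu>. \<forall>\<mu>\<le>\<rho>. compose (points (X \<mu>)) (u \<rho>) (f \<mu> \<rho>) = u \<mu>) \<longrightarrow>
             (\<exists>!w. w \<in> md_hom (X \<nu>) E \<and>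
                   (\<forall>\<mu><\<nu>. compose (points (X \<mu>)) w (f \<mu> \<nu>) = u \<mu>))))"


section \<open>Cellular objects\<close>

text \<open>Ordinals are elements of a well-ordered type; \<open>index_succ \<nu>\<close> is only used when there is an
  element above \<open>\<nu>\<close>.\<close>

definition index_zero :: "'i::wellorder" where
  "index_zero = (LEAST \<nu>. True)"

definition index_succ :: "'i::wellorder \<Rightarrow> 'i" where
  "index_succ \<nu> = (LEAST \<mu>. \<nu> < \<mu>)"

definition index_limit :: "'i::wellorder \<Rightarrow> bool" where
  "index_limit \<nu> \<longleftrightarrow> (\<exists>\<mu>. \<mu> < \<nu>) \<and> (\<forall>\<mu><\<nu>. index_succ \<mu> < \<nu>)"

text \<open>The stages \<open>stage C \<nu>\<close> are relevant for \<open>\<nu> \<le> top_index C\<close>, the maps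
  \<open>transition C \<mu> \<nu> : stage C \<mu> \<rightarrow> stage C \<nu>\<close> for \<open>\<mu> \<le> \<nu> \<le> top_index C\<close>, and the cells for
  \<open>\<nu> < top_index C\<close>: \<open>cell_dim C \<nu>\<close> is the dimension of the disk, \<open>attach C \<nu>\<close> the attaching map
  to \<open>stage C \<nu>\<close>, and \<open>char_map C \<nu>\<close> the resulting map from the globe of the disk to
  \<open>stage C (index_succ \<nu>)\<close>.\<close>

record ('i, 'a) tower =
  top_index :: 'i
  stage :: "'i \<Rightarrow> 'a mdspace"
  transition :: "'i \<Rightarrow> 'i \<Rightarrow> 'a \<Rightarrow> 'a"
  cell_dim :: "'i \<Rightarrow> nat"
  attach :: "'i \<Rightarrow> (nat \<Rightarrow> real) glob \<Rightarrow> 'a"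
  char_map :: "'i \<Rightarrow> (nat \<Rightarrow> real) glob \<Rightarrow> 'a"

definition last_stage :: "('i, 'a) tower \<Rightarrow> 'a mdspace" where
  "last_stage C = stage C (top_index C)"

definition is_transfinite_sequence ::
  "top_category \<Rightarrow> (real \<Rightarrow> real) set \<Rightarrow> ('i::wellorder, 'a) tower \<Rightarrow> bool" where
  "is_transfinite_sequence T P C \<longleftrightarrow>
     (\<forall>\<nu>\<le>top_index C. is_mdspace T P (stage C \<nu>)) \<and>
     (\<forall>\<nu>\<le>top_index C. \<forall>\<mu>\<le>\<nu>. transition C \<mu> \<nu> \<in> md_hom (stage C \<mu>) (stage C \<nu>)) \<and>
     (\<forall>\<nu>\<le>top_index C. transition C \<nu> \<nu> = (\<lambda>x\<in>points (stage C \<nu>). x)) \<and>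
     (\<forall>\<rho>\<le>top_index C. \<forall>\<nu>\<le>\<rho>. \<forall>\<mu>\<le>\<nu>.
        compose (points (stage C \<mu>)) (transition C \<nu> \<rho>) (transition C \<mu> \<nu>) = transition C \<mu> \<rho>)"

text \<open>The test type contains a copy of \<open>'a\<close>, of the coproduct of all stages, and of the coproduct
  of a stage and a globe.\<close>

definition is_cellular ::
  "top_category \<Rightarrow> (real \<Rightarrow> real) set \<Rightarrow> ('i::wellorder, 'a) tower \<Rightarrow> bool" where
  "is_cellular T P C \<longleftrightarrow>
     is_transfinite_sequence T P C \<and>
     (\<exists>S. stage C index_zero = discrete_mdspace S) \<and>
     (\<forall>\<nu><top_index C.
        is_pushout TYPE(('i \<times> 'a) + (nat \<Rightarrow> real) glob) T P
          (Glob P (disk_boundary (cell_dim C \<nu>))) (Glob P (disk (cell_dim C \<nu>)))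
          (stage C \<nu>) (stage C (index_succ \<nu>))
          (glob_incl (cell_dim C \<nu>)) (attach C \<nu>) (char_map C \<nu>) (transition C \<nu> (index_succ \<nu>))) \<and>
     (\<forall>\<nu>\<le>top_index C. index_limit \<nu> \<longrightarrow>
        is_seq_colimit TYPE(('i \<times> 'a) + (nat \<Rightarrow> real) glob) T P (stage C) (transition C) \<nu>)"

definition cell_map ::
  "(real \<Rightarrow> real) set \<Rightarrow> ('i::wellorder, 'a) tower \<Rightarrow> 'i \<Rightarrow> (nat \<Rightarrow> real) glob \<Rightarrow> 'a" where
  "cell_map P C \<nu> =
     compose (points (Glob P (disk (cell_dim C \<nu>))))
       (transition C (index_succ \<nu>) (top_index C)) (char_map C \<nu>)"


section \<open>Moore composition and natural length\<close>

text \<open>A Moore path is a pair of a length \<open>\<ell>\<close> and a map on \<open>{0..\<ell>}\<close>.\<close>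

type_synonym 'a moore_path = "real \<times> (real \<Rightarrow> 'a)"

fun moore_comp :: "'a moore_path \<Rightarrow> 'a moore_path \<Rightarrow> 'a moore_path" where
  "moore_comp (l1, \<gamma>1) (l2, \<gamma>2) =
     (l1 + l2, \<lambda>t\<in>{0..l1 + l2}. if t \<le> l1 then \<gamma>1 t else \<gamma>2 (t - l1))"

definition moore_composable :: "'a moore_path \<Rightarrow> 'a moore_path \<Rightarrow> bool" where
  "moore_composable p q \<longleftrightarrow> snd p (fst p) = snd q 0"

text \<open>Moore composition is associative; only nonempty lists matter.\<close>

fun moore_concat :: "'a moore_path list \<Rightarrow> 'a moore_path" where
  "moore_concat [] = undefined"
| "moore_concat [p] = p"
| "moore_concat (p # q # ps) = moore_comp p (moore_concat (q # ps))"

text \<open>The factor \<open>cell_map P C \<nu> \<circ> glob_path z \<circ> \<phi> \<circ> \<mu>\<^sub>\<ell>\<close> with \<open>\<mu>\<^sub>\<ell> t = t / \<ell>\<close>.\<close>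

definition cell_segment ::
  "(real \<Rightarrow> real) set \<Rightarrow> ('i::wellorder, 'a) tower \<Rightarrow>
   'i \<times> (nat \<Rightarrow> real) \<times> (real \<Rightarrow> real) \<times> real \<Rightarrow> 'a moore_path" where
  "cell_segment P C =
     (\<lambda>(\<nu>, z, \<phi>, l). (l, \<lambda>t\<in>{0..l}. cell_map P C \<nu> (glob_path z (\<phi> (t / l)))))"

definition is_natural_decomposition ::
  "(real \<Rightarrow> real) set \<Rightarrow> ('i::wellorder, 'a) tower \<Rightarrow> (real \<Rightarrow> 'a) \<Rightarrow>
   ('i \<times> (nat \<Rightarrow> real) \<times> (real \<Rightarrow> real) \<times> real) list \<Rightarrow> bool" where
  "is_natural_decomposition P C \<gamma> ds \<longleftrightarrow>
     ds \<noteq> [] \<and>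
     (\<forall>(\<nu>, z, \<phi>, l) \<in> set ds.
        \<nu> < top_index C \<and>
        z \<in> topspace (disk (cell_dim C \<nu>)) - topspace (disk_boundary (cell_dim C \<nu>)) \<and>
        \<phi> \<in> P \<and> 0 < l) \<and>
     (\<Sum>(\<nu>, z, \<phi>, l) \<leftarrow> ds. l) = 1 \<and>
     successively moore_composable (map (cell_segment P C) ds) \<and>
     \<gamma> = snd (moore_concat (map (cell_segment P C) ds))"

definition natural_length ::
  "(real \<Rightarrow> real) set \<Rightarrow> ('i::wellorder, 'a) tower \<Rightarrow> (real \<Rightarrow> 'a) \<Rightarrow> nat" where
  "natural_length P C \<gamma> = (THE N. \<exists>ds. is_natural_decomposition P C \<gamma> ds \<and> length ds = N)"

end

theory Submission
  imports Defs
begin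

text \<open>
  The proof measures execution paths with a single real function. Call a continuous function
  \<open>h\<close> from a multipointed d-space to \<open>[0,1]\<close> a peak function if it vanishes on the states and takes
  the value 1 somewhere on every execution path. A cellular object has one
  (\<open>cellular_has_peak_function\<close>). This suffices. The map \<open>(u, t) \<mapsto> h (\<psi> u t)\<close> is continuous on the
  compact square, because evaluation is continuous for the compact-open topology
  (\<open>compact_open_evaluation_continuous\<close>), so there is a \<open>\<delta> > 0\<close> such that \<open>h \<circ> \<psi> u\<close> varies by less
  than 1 over times closer than \<open>\<delta>\<close>, for all \<open>u\<close> at once. Every factor of a natural decomposition of
  \<open>\<psi> u\<close> is a reparametrised execution path, hence starts at height 0 and reaches height 1, and so
  it lasts at least \<open>\<delta>\<close>. As the factors last 1 in total, there are at most \<open>1/\<delta>\<close> of them.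

  Peak functions are built cell by cell. They are the maps into one object, \<open>peak_space\<close>, namely a
  copy of \<open>[0,1]\<close> with the single state 0, whose execution paths are the loops at 0 that reach 1. The
  universal properties of pushouts and transfinite colimits therefore reduce the construction to
  one cell: a peak function on the globe of a sphere has to extend to the globe of the disk
  (\<open>peak_function_extends_over_globe\<close>). Such an extension contracts a family of loops, and
  the loops in \<open>[0,1]\<close> at 0 with maximum 1 can be contracted explicitly: first raise a loop to its
  pointwise maximum with the tent function \<open>1 - |2t - 1|\<close>, then shrink the original loop away.
  At each moment one of the two functions under the maximum has full height, so 1 is still reached.
\<close>

section \<open>Continuity and kelleyfication\<close>

lemma continuous_map_into_kelleyficationD:
  assumes "continuous_map Z (kelleyfication Y) f"
  shows "continuous_map Z Y f"
proof -
  have "openin (kelleyfication Y) U" if "openin Y U" for U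
    unfolding openin_kelleyfication
  proof (intro conjI allI impI)
    show "U \<subseteq> topspace Y" using that by (rule openin_subset)
    fix c assume "continuous_map I01 Y c"
    from openin_continuous_map_preimage[OF this that]
    show "openin I01 {t \<in> {0..1}. c t \<in> U}" by simp
  qed
  then show ?thesis
    using assms by (auto simp: continuous_map_def)
qed

lemma path_into_kelleyfication:
  assumes "continuous_map I01 Y c"
  shows "continuous_map I01 (kelleyfication Y) c"
  using assms by (auto simp: continuous_map_def openin_kelleyfication)

text \<open>Open sets of a kelleyfication are detected by paths, so continuity out of it can be
  tested along paths. Constant paths show that the values lie in the target.\<close>

lemma continuous_map_from_kelleyfication:
  assumes "\<And>c. continuous_map I01 Y c \<Longrightarrow> continuous_map I01 Z (f \<circ> c)"
  shows "continuous_map (kelleyfication Y) Z f"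
proof -
  have "f y \<in> topspace Z" if "y \<in> topspace Y" for y
  proof -
    have "continuous_map I01 Z (f \<circ> (\<lambda>_. y))"
      by (rule assms) (simp add: that)
    from funcset_mem[OF continuous_map_funspace[OF this], of 0]
    show ?thesis
      by simp
  qed
  moreover have "openin (kelleyfication Y) {y \<in> topspace Y. f y \<in> U}" if "openin Z U" for U
    unfolding openin_kelleyfication
  proof (intro conjI allI impI)
    fix c assume c: "continuous_map I01 Y c"
    have "openin I01 {t \<in> topspace I01. (f \<circ> c) t \<in> U}"
      using openin_continuous_map_preimage[OF assms[OF c] that] .
    moreover have "{t \<in> topspace I01. (f \<circ> c) t \<in> U} = {t \<in> {0..1}. c t \<in> {y \<in> topspace Y. f y \<in> U}}"
      using c by (auto simp: continuous_map_def)
    ultimately show "openin I01 {t \<in> {0..1}. c t \<in> {y \<in> topspace Y. f y \<in> U}}"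
      by simp
  qed auto
  ultimately show ?thesis
    by (auto simp: continuous_map_def)
qed

lemma openin_glob_space:
  "openin (glob_space Z) U \<longleftrightarrow>
     U \<subseteq> topspace (glob_space Z) \<and>
     openin (kelleyfication (prod_topology Z I01)) {y \<in> topspace Z \<times> {0..1}. glob_pt y \<in> U}"
  unfolding topspace_glob_space unfolding glob_space_def openin_final_topology by simp

lemma continuous_map_from_glob_space:
  assumes "continuous_map (kelleyfication (prod_topology Z I01)) W (f \<circ> glob_pt)"
    and "f Bot \<in> topspace W" "f Top \<in> topspace W"
  shows "continuous_map (glob_space Z) W f"
proof -
  let ?K = "kelleyfication (prod_topology Z I01)"
  have m: "f (glob_pt y) \<in> topspace W" if "y \<in> topspace Z \<times> {0..1}" for y
    using assms(1) that by (fastforce simp: continuous_map_def Pi_iff)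
  then have F: "f \<in> topspace (glob_space Z) \<rightarrow> topspace W"
    using assms(2,3) by (auto simp: topspace_glob_space)
  have "openin (glob_space Z) {x \<in> topspace (glob_space Z). f x \<in> U}" if "openin W U" for U
  proof -
    have "openin ?K {y \<in> topspace ?K. (f \<circ> glob_pt) y \<in> U}"
      using assms(1) that by (rule openin_continuous_map_preimage)
    moreover have "{y \<in> topspace ?K. (f \<circ> glob_pt) y \<in> U}
        = {y \<in> topspace Z \<times> {0..1}. glob_pt y \<in> {x \<in> topspace (glob_space Z). f x \<in> U}}"
      by (auto simp: topspace_glob_space)
    ultimately show ?thesis
      unfolding openin_glob_space by auto
  qed
  with F show ?thesis
    by (auto simp: continuous_map_def)
qed

lemma continuous_map_glob_pt:
  "continuous_map (kelleyfication (prod_topology Z I01)) (glob_space Z) glob_pt"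
  by (auto simp: continuous_map_def openin_glob_space) (auto simp: topspace_glob_space)

text \<open>A function that is continuous along every path \<open>[0,1] \<rightarrow> Y\<close> is also continuous along a map defined
  only on an open part \<open>S\<close> of \<open>[0,1]\<close>: clamping the parameter to a small interval around a
  point of \<open>S\<close> turns the map into a path on all of \<open>[0,1]\<close> without changing it near that point.\<close>

lemma continuous_on_local_path:
  fixes f :: "'b \<Rightarrow> real"
  assumes S: "openin I01 S"
    and h: "continuous_map (top_of_set S) Y h"
    and f: "continuous_map (kelleyfication Y) euclideanreal f"
  shows "continuous_on S (f \<circ> h)"
proof -
  have sub: "S \<subseteq> {0..1}" using openin_subset[OF S] by simp
  obtain V where V: "open V" "S = {0..1} \<inter> V"
    using S by (auto simp: openin_open)
  show ?thesis
    unfolding continuous_on_eq_continuous_within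
  proof
    fix s assume s: "s \<in> S"
    with V obtain e where e: "e > 0" "cball s e \<subseteq> V"
      by (meson IntD2 open_contains_cball)
    define a where "a = max 0 (s - e)"
    define b where "b = min 1 (s + e)"
    \<comment> \<open>the retraction of the line onto the interval from \<open>a\<close> to \<open>b\<close>\<close>
    define k where "k x = max a (min b x)" for x
    have ab: "a \<le> b" "s \<in> {0..1}" "{a..b} \<subseteq> S"
      using s sub e V by (auto simp: a_def b_def cball_def dist_real_def subset_iff abs_if)
    have "k ` {0..1} \<subseteq> S"
      using ab by (auto simp: k_def subset_iff max_def min_def)
    moreover have "continuous_on {0..1} k"
      unfolding k_def by (intro continuous_intros)
    ultimately have "continuous_map I01 (top_of_set S) k"
      by auto
    then have "continuous_map I01 Y (h \<circ> k)"
      using h by (rule continuous_map_compose)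
    then have "continuous_map I01 euclideanreal (f \<circ> (h \<circ> k))"
      using f path_into_kelleyfication continuous_map_compose by blast
    then have "continuous_on {0..1} (f \<circ> (h \<circ> k))"
      by simp
    then have "continuous (at s within S) (f \<circ> (h \<circ> k))"
      using ab(2) sub continuous_on_eq_continuous_within continuous_within_subset by blast
    then show "continuous (at s within S) (f \<circ> h)"
    proof (rule continuous_transform_within[OF _ e(1) s])
      fix x assume "x \<in> S" "dist x s < e"
      then have "k x = x"
        using sub by (auto simp: k_def a_def b_def dist_real_def)
      then show "(f \<circ> (h \<circ> k)) x = (f \<circ> h) x"
        by simp
    qed
  qed
qed

section \<open>Reparametrisations\<close>

lemma reparam_G_subset_reparam_M: "reparam_G \<subseteq> reparam_M"
  unfolding reparam_G_def reparam_M_def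
  using homeomorphic_imp_surjective_map by fastforce

text \<open>A monotone function can only fail to be continuous by omitting values, which surjectivity excludes.
  As monotone functions with open image are continuous, \<open>\<phi>\<close> is extended by the identity to a
  monotone surjection of the line.\<close>

lemma reparam_M_properties:
  assumes "\<phi> \<in> reparam_M"
  shows "continuous_on {0..1} \<phi>" "\<phi> ` {0..1} = {0..1}" "\<phi> 0 = 0" "\<phi> 1 = 1"
proof -
  have mono: "\<phi> x \<le> \<phi> y" if "0 \<le> x" "x \<le> y" "y \<le> 1" for x y
    using assms that by (auto simp: reparam_M_def mono_on_def)
  show im: "\<phi> ` {0..1} = {0..1}"
    using assms by (simp add: reparam_M_def)
  have r: "0 \<le> \<phi> x \<and> \<phi> x \<le> 1" if "0 \<le> x" "x \<le> 1" for x
    using im that by (metis atLeastAtMost_iff imageI)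
  have "0 \<in> \<phi> ` {0..1}" "1 \<in> \<phi> ` {0..1}"
    unfolding im by simp_all
  then obtain x y where "x \<in> {0..1}" "\<phi> x = 0" "y \<in> {0..1}" "\<phi> y = 1"
    by (elim imageE) metis
  then show "\<phi> 0 = 0" "\<phi> 1 = 1"
    using mono[of 0 x] mono[of y 1] r[of 0] r[of 1] by auto
  define \<phi>' where "\<phi>' x = (if x \<in> {0..1} then \<phi> x else x)" for x
  have "range \<phi>' = UNIV"
  proof -
    have "y \<in> range \<phi>'" for y
    proof (cases "y \<in> {0..1}")
      case True
      then obtain x where "x \<in> {0..1}" "\<phi> x = y" using im by (metis imageE)
      then have "\<phi>' x = y" by (simp add: \<phi>'_def)
      then show ?thesis by blast
    next
      case False
      then have "\<phi>' y = y" by (auto simp: \<phi>'_def)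
      then show ?thesis by (metis rangeI)
    qed
    then show ?thesis by blast
  qed
  moreover have "\<phi>' x \<le> \<phi>' y" if "x \<le> y" for x y
    using that mono[of x y] r[of x] r[of y] by (auto simp: \<phi>'_def)
  ultimately have "continuous_on UNIV \<phi>'"
    by (intro continuous_onI_mono) auto
  then have "continuous_on {0..1} \<phi>'"
    using continuous_on_subset by blast
  then show "continuous_on {0..1} \<phi>"
    by (rule continuous_on_eq) (simp add: \<phi>'_def)
qed

section \<open>Peak functions and the object that classifies them\<close>

text \<open>The universal properties of a cellular object are only tested against objects whose points form a
  prescribed type, so the interval has to be transported into that type along an injection \<open>e\<close>.\<close>

definition peak_space :: "(real \<Rightarrow> 't) \<Rightarrow> 't mdspace" where
  "peak_space e =
     (let E = pullback_topology (e ` {0..1}) (inv e) euclideanreal in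
      \<lparr>carrier_space = E, states = {e 0},
       expaths = {\<gamma> \<in> cmaps I01 E. \<gamma> 0 = e 0 \<and> \<gamma> 1 = e 0 \<and> e 1 \<in> \<gamma> ` {0..1}}\<rparr>)"

definition peak_function :: "'a mdspace \<Rightarrow> ('a \<Rightarrow> real) \<Rightarrow> bool" where
  "peak_function X h \<longleftrightarrow>
     continuous_map (carrier_space X) I01 h \<and>
     (\<forall>x\<in>states X. h x = 0) \<and>
     (\<forall>\<gamma>\<in>expaths X. \<exists>t\<in>{0..1}. h (\<gamma> t) = 1)"

lemma points_peak_space:
  assumes "inj e"
  shows "points (peak_space e) = e ` {0..1}"
  using assms by (auto simp: peak_space_def topspace_pullback_topology)

lemma continuous_map_into_peak_space:
  assumes e: "inj e"
  shows "continuous_map Z (carrier_space (peak_space e)) f \<longleftrightarrow>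
     continuous_map Z I01 (inv e \<circ> f) \<and> f \<in> topspace Z \<rightarrow> e ` {0..1}" (is "?l \<longleftrightarrow> ?r")
proof
  let ?E = "pullback_topology (e ` {0..1}) (inv e) euclideanreal"
  assume l: ?l
  then have f: "f \<in> topspace Z \<rightarrow> e ` {0..1}"
    using continuous_map_funspace[OF l] by (simp add: points_peak_space[OF e])
  have "continuous_map ?E euclideanreal (id \<circ> inv e)"
    by (rule continuous_map_pullback) simp
  then have "continuous_map Z euclideanreal (inv e \<circ> f)"
    using continuous_map_compose[of Z ?E f euclideanreal "id \<circ> inv e"] l
    by (simp add: peak_space_def)
  with f show ?r
    using e by (auto simp: continuous_map_in_subtopology Pi_iff)
next
  let ?E = "pullback_topology (e ` {0..1}) (inv e) euclideanreal"
  assume r: ?r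
  then have "continuous_map Z ?E f"
    by (intro continuous_map_pullback') (auto simp: continuous_map_in_subtopology Pi_iff)
  then show ?l
    by (simp add: peak_space_def)
qed

text \<open>Since \<open>e\<close> itself is a path in the copy of \<open>[0,1]\<close>, a set that is open along all paths is open.
  The image of a path is compact in a Hausdorff space, hence closed.\<close>

lemma Top_space_peak_space:
  assumes e: "inj e"
  shows "Top_space T (carrier_space (peak_space e))"
proof -
  let ?E = "carrier_space (peak_space e)"
  have op: "openin ?E U \<longleftrightarrow> (\<exists>V. open V \<and> U = inv e -` V \<inter> e ` {0..1})" for U
    by (auto simp: peak_space_def openin_pullback_topology)
  have cont_e: "continuous_map I01 ?E e"
    using e by (auto simp: continuous_map_into_peak_space o_def)
  have "openin (kelleyfication ?E) U \<longleftrightarrow> openin ?E U" for U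
  proof
    assume U: "openin (kelleyfication ?E) U"
    then have "openin I01 {t \<in> {0..1}. e t \<in> U}"
      using cont_e by (simp add: openin_kelleyfication)
    then obtain V where "open V" "{t \<in> {0..1}. e t \<in> U} = {0..1} \<inter> V"
      by (metis openin_open)
    moreover have "U \<subseteq> e ` {0..1}"
      using U openin_subset points_peak_space[OF e] by fastforce
    ultimately have "open V \<and> U = inv e -` V \<inter> e ` {0..1}"
      using e by (force simp: set_eq_iff)
    then show "openin ?E U"
      using op by blast
  next
    assume U: "openin ?E U"
    show "openin (kelleyfication ?E) U"
      unfolding openin_kelleyfication
    proof (intro conjI allI impI)
      show "U \<subseteq> topspace ?E" using U by (rule openin_subset)
      fix c assume "continuous_map I01 ?E c"
      from openin_continuous_map_preimage[OF this U]
      show "openin I01 {t \<in> {0..1}. c t \<in> U}" by simp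
    qed
  qed
  then have "kelleyfication ?E = ?E"
    by (simp add: topology_eq)
  moreover have "closedin ?E (c ` {0..1})" if c: "continuous_map I01 ?E c" for c
  proof -
    have r: "continuous_on {0..1} (inv e \<circ> c)" "c ` {0..1} \<subseteq> e ` {0..1}"
      using c by (auto simp: continuous_map_into_peak_space[OF e])
    then have "compact ((inv e \<circ> c) ` {0..1})"
      by (intro compact_continuous_image) auto
    then have "open (- (inv e \<circ> c) ` {0..1})"
      by (intro open_Compl compact_imp_closed)
    moreover have "points (peak_space e) - c ` {0..1} = inv e -` (- (inv e \<circ> c) ` {0..1}) \<inter> e ` {0..1}"
    proof -
      have "x = y" if "inv e x = inv e y" "x \<in> e ` {0..1}" "y \<in> e ` {0..1}" for x y
        using that e by auto
      then have "x \<in> c ` {0..1} \<longleftrightarrow> inv e x \<in> (inv e \<circ> c) ` {0..1}" if "x \<in> e ` {0..1}" for x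
        using that r(2) unfolding image_comp[symmetric] by blast
      then show ?thesis
        unfolding points_peak_space[OF e] by blast
    qed
    ultimately have "openin ?E (points (peak_space e) - c ` {0..1})"
      unfolding op by blast
    then show ?thesis
      using r(2) by (simp add: closedin_def points_peak_space[OF e])
  qed
  ultimately show ?thesis
    by (simp add: Top_space_def)
qed

lemma norm_comp_continuous:
  fixes a b :: "real \<Rightarrow> real"
  assumes "continuous_on {0..1} a" "continuous_on {0..1} b" "a 1 = b 0"
  shows "continuous_on {0..1} (\<lambda>t. if t \<le> 1/2 then a (2 * t) else b (2 * t - 1))"
proof (rule continuous_on_cases_le)
  show "continuous_on {t \<in> {0..1}. t \<le> 1/2} (\<lambda>t. a (2 * t))"
    by (rule continuous_on_compose2[OF assms(1)]) (auto intro!: continuous_intros)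
  show "continuous_on {t \<in> {0..1}. 1/2 \<le> t} (\<lambda>t. b (2 * t - 1))"
    by (rule continuous_on_compose2[OF assms(2)]) (auto intro!: continuous_intros)
next
  fix t :: real assume "t \<in> {0..1}" "t = 1/2"
  then have "2 * t = 1" by simp
  then show "a (2 * t) = b (2 * t - 1)"
    using assms(3) by simp
qed (intro continuous_intros)

text \<open>Precomposing with a surjection keeps the image of a loop, and the image of a composition
  contains that of the first loop, so the value 1 is not lost.\<close>

lemma is_mdspace_peak_space:
  assumes e: "inj e" and P: "P \<subseteq> reparam_M"
  shows "is_mdspace T P (peak_space e)"
proof -
  let ?X = "peak_space e"
  let ?E = "carrier_space ?X"
  have ex: "\<gamma> \<in> expaths ?X \<longleftrightarrow> \<gamma> \<in> extensional {0..1} \<and> continuous_on {0..1} (inv e \<circ> \<gamma>) \<and>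
      \<gamma> ` {0..1} \<subseteq> e ` {0..1} \<and> \<gamma> 0 = e 0 \<and> \<gamma> 1 = e 0 \<and> e 1 \<in> \<gamma> ` {0..1}" for \<gamma>
  proof -
    have "\<gamma> \<in> expaths ?X \<longleftrightarrow> \<gamma> \<in> extensional {0..1} \<and> continuous_map I01 ?E \<gamma> \<and> 
       \<gamma> 0 = e 0 \<and> \<gamma> 1 = e 0 \<and> e 1 \<in> \<gamma> ` {0..1}"
      by (auto simp: peak_space_def cmaps_def)
    moreover have "(inv e \<circ> \<gamma>) ` {0..1} \<subseteq> {0..1}" if "\<gamma> ` {0..1} \<subseteq> e ` {0..1}"
      using image_mono[OF that, of "inv e"] e unfolding image_comp[symmetric] by simp
    ultimately show ?thesis
      unfolding continuous_map_into_peak_space[OF e]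
      by (auto simp flip: image_subset_iff_funcset)
  qed
  have "compose {0..1} \<gamma> \<phi> \<in> expaths ?X" if g: "\<gamma> \<in> expaths ?X" and "\<phi> \<in> P" for \<gamma> \<phi>
  proof -
    have \<phi>: "continuous_on {0..1} \<phi>" "\<phi> ` {0..1} = {0..1}" "\<phi> 0 = 0" "\<phi> 1 = 1"
      using reparam_M_properties[of \<phi>] that(2) P by auto
    have "continuous_on {0..1} ((inv e \<circ> \<gamma>) \<circ> \<phi>)"
      using g \<phi> ex by (intro continuous_on_compose) auto
    then have "continuous_on {0..1} (inv e \<circ> compose {0..1} \<gamma> \<phi>)"
      by (rule continuous_on_eq) (simp add: compose_def)
    moreover have "compose {0..1} \<gamma> \<phi> ` {0..1} = \<gamma> ` {0..1}"
    proof -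
      have "compose {0..1} \<gamma> \<phi> ` {0..1} = (\<gamma> \<circ> \<phi>) ` {0..1}"
        by (intro image_cong) (simp_all add: compose_def)
      then show ?thesis
        using \<phi>(2) by (simp only: image_comp[symmetric])
    qed
    ultimately show ?thesis
      using g \<phi> unfolding ex by (simp add: compose_def)
  qed
  moreover have "norm_comp \<gamma> \<delta> \<in> expaths ?X" if g: "\<gamma> \<in> expaths ?X" and d: "\<delta> \<in> expaths ?X" for \<gamma> \<delta>
  proof -
    let ?n = "norm_comp \<gamma> \<delta>"
    have "continuous_on {0..1} (\<lambda>t. if t \<le> 1/2 then (inv e \<circ> \<gamma>) (2 * t) else (inv e \<circ> \<delta>) (2 * t - 1))"
      using g d unfolding ex by (intro norm_comp_continuous) auto
    then have "continuous_on {0..1} (inv e \<circ> ?n)"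
      by (rule continuous_on_eq) (simp add: norm_comp_def)
    moreover have "?n ` {0..1} \<subseteq> e ` {0..1}"
      using g d unfolding ex norm_comp_def by (auto simp: image_subset_iff)
    moreover obtain s where s: "s \<in> {0..1}" "\<gamma> s = e 1"
      using g unfolding ex by (metis imageE)
    then have "?n (s / 2) = \<gamma> s" "s / 2 \<in> {0..1}"
      by (simp_all add: norm_comp_def)
    then have "e 1 \<in> ?n ` {0..1}"
      using s(2) by (intro image_eqI[of _ _ "s / 2"]) simp_all
    ultimately show ?thesis
      using g d unfolding ex by (simp add: norm_comp_def)
  qed
  moreover have "expaths ?X \<subseteq> cmaps I01 ?E" "states ?X = {e 0}"
    "\<And>\<gamma>. \<gamma> \<in> expaths ?X \<Longrightarrow> \<gamma> 0 = e 0" "\<And>\<gamma>. \<gamma> \<in> expaths ?X \<Longrightarrow> \<gamma> 1 = e 0"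
    by (auto simp: peak_space_def)
  ultimately show ?thesis
    unfolding is_mdspace_def using Top_space_peak_space[OF e]
    by (simp add: points_peak_space[OF e])
qed

lemma peak_function_of_hom:
  assumes e: "inj e" and w: "w \<in> md_hom X (peak_space e)"
  shows "peak_function X (inv e \<circ> w)"
proof -
  have "\<exists>t\<in>{0..1}. (inv e \<circ> w) (\<gamma> t) = 1" if "\<gamma> \<in> expaths X" for \<gamma>
  proof -
    have "e 1 \<in> compose {0..1} w \<gamma> ` {0..1}"
      using w that by (auto simp: md_hom_def peak_space_def)
    then obtain t where "t \<in> {0..1}" "w (\<gamma> t) = e 1"
      by (auto simp: compose_def)
    then show ?thesis
      using e by (metis comp_apply inv_f_f)
  qed
  moreover have "continuous_map (carrier_space X) I01 (inv e \<circ> w)"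
    using w continuous_map_into_peak_space[OF e] by (auto simp: md_hom_def cmaps_def)
  moreover have "(inv e \<circ> w) x = 0" if "x \<in> states X" for x
  proof -
    have "w x = e 0" using w that by (auto simp: md_hom_def peak_space_def)
    then show ?thesis using e by simp
  qed
  ultimately show ?thesis
    by (auto simp: peak_function_def)
qed

lemma hom_of_peak_function:
  assumes e: "inj e" and h: "peak_function X h"
    and X: "states X \<subseteq> points X" "expaths X \<subseteq> cmaps I01 (carrier_space X)"
      "\<And>\<gamma>. \<gamma> \<in> expaths X \<Longrightarrow> \<gamma> 0 \<in> states X \<and> \<gamma> 1 \<in> states X"
  shows "(\<lambda>x\<in>points X. e (h x)) \<in> md_hom X (peak_space e)" (is "?w \<in> _")
proof -
  have h01: "h x \<in> {0..1}" if "x \<in> points X" for x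
    using h that funcset_mem[OF continuous_map_funspace, of "carrier_space X" I01 h]
    by (simp add: peak_function_def)
  have "continuous_map (carrier_space X) I01 (inv e \<circ> ?w)"
    using h e by (auto simp: peak_function_def elim!: continuous_map_eq)
  then have w: "continuous_map (carrier_space X) (carrier_space (peak_space e)) ?w"
    using h01 by (auto simp: continuous_map_into_peak_space[OF e])
  have "compose {0..1} ?w \<gamma> \<in> expaths (peak_space e)" if g: "\<gamma> \<in> expaths X" for \<gamma>
  proof -
    have c: "continuous_map I01 (carrier_space X) \<gamma>" 
      using X(2) g by (auto simp: cmaps_def)
    then have p: "\<gamma> t \<in> points X" if "t \<in> {0..1}" for t
      using that funcset_mem[OF continuous_map_funspace[OF c]] by simp
    have "continuous_map I01 (carrier_space (peak_space e)) (?w \<circ> \<gamma>)"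
      using c w by (rule continuous_map_compose)
    then have "continuous_map I01 (carrier_space (peak_space e)) (compose {0..1} ?w \<gamma>)"
      by (rule continuous_map_eq) (simp add: compose_def)
    then have "compose {0..1} ?w \<gamma> \<in> cmaps I01 (carrier_space (peak_space e))"
      by (simp add: cmaps_def compose_def)
    moreover have "h (\<gamma> 0) = 0" "h (\<gamma> 1) = 0"
      using h X(3)[OF g] by (auto simp: peak_function_def)
    moreover obtain t where "t \<in> {0..1}" "h (\<gamma> t) = 1"
      using h g by (auto simp: peak_function_def)
    then have "compose {0..1} ?w \<gamma> t = e 1" "t \<in> {0..1}"
      using p by (auto simp: compose_def)
    then have "e 1 \<in> compose {0..1} ?w \<gamma> ` {0..1}"
      by (intro image_eqI[of _ _ t]) simp_all
    ultimately show ?thesis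
      using p by (auto simp: peak_space_def compose_def)
  qed
  moreover have "?w ` states X \<subseteq> states (peak_space e)"
    using X(1) h by (auto simp: peak_space_def peak_function_def)
  ultimately show ?thesis
    using w by (auto simp: md_hom_def cmaps_def)
qed

lemma peak_function_compose:
  assumes h: "peak_function Y h" and g: "g \<in> md_hom X Y"
  shows "peak_function X (h \<circ> g)"
proof -
  have "continuous_map (carrier_space X) I01 (h \<circ> g)"
    using g h continuous_map_compose by (auto simp: md_hom_def cmaps_def peak_function_def)
  moreover have "\<exists>t\<in>{0..1}. (h \<circ> g) (\<gamma> t) = 1" if "\<gamma> \<in> expaths X" for \<gamma>
  proof -
    have "compose {0..1} g \<gamma> \<in> expaths Y" using g that by (auto simp: md_hom_def)
    then obtain t where "t \<in> {0..1}" "h (compose {0..1} g \<gamma> t) = 1"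
      using h by (auto simp: peak_function_def)
    then show ?thesis by (auto simp: compose_def)
  qed
  ultimately show ?thesis
    using g h by (auto simp: md_hom_def peak_function_def)
qed

section \<open>Extending a peak function from a sphere to a disk\<close>

abbreviation disk_radius :: "nat \<Rightarrow> (nat \<Rightarrow> real) \<Rightarrow> real" where
  "disk_radius n z \<equiv> sqrt (\<Sum>i<n. (z i)\<^sup>2)"

text \<open>A family \<open>G\<close> of loops over the sphere is extended over the disk by contracting along the radius \<open>r\<close>.
  From \<open>r = 1\<close> to \<open>r = 1/2\<close> the tent function grows from 0 to full size, under a maximum with the
  loop \<open>G (z/r)\<close>; from \<open>r = 1/2\<close> to \<open>r = 0\<close> the loop is scaled down to 0, which also makes
  the undefined direction \<open>z/r\<close> at the centre harmless. For every \<open>r\<close> one of the two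
  factors is 1.\<close>

definition cone_peak :: "nat \<Rightarrow> ((nat \<Rightarrow> real) \<times> real \<Rightarrow> real) \<Rightarrow> (nat \<Rightarrow> real) \<times> real \<Rightarrow> real" where
  "cone_peak n G = (\<lambda>(z, t).
     max (min 1 (2 * disk_radius n z) * G (\<lambda>i. z i / disk_radius n z, t))
         (min 1 (2 - 2 * disk_radius n z) * (1 - \<bar>2 * t - 1\<bar>)))"

lemma topspace_disk: "topspace (disk n) = {z. (\<forall>i\<ge>n. z i = 0) \<and> disk_radius n z \<le> 1}"
  by (auto simp: disk_def topspace_Euclidean_space)

lemma topspace_disk_boundary:
  "topspace (disk_boundary n) = {z. (\<forall>i\<ge>n. z i = 0) \<and> disk_radius n z = 1}"
  by (auto simp: disk_boundary_def topspace_Euclidean_space)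

lemma disk_radius_nonneg: "0 \<le> disk_radius n z"
  by (simp add: sum_nonneg)

lemma disk_radius_divide:
  assumes "disk_radius n z > 0"
  shows "disk_radius n (\<lambda>i. z i / disk_radius n z) = 1"
proof -
  have "(\<Sum>i<n. (z i / disk_radius n z)\<^sup>2) = (\<Sum>i<n. (z i)\<^sup>2) / (disk_radius n z)\<^sup>2"
    by (simp only: power_divide sum_divide_distrib)
  also have "\<dots> = 1"
    using assms by (simp add: sum_nonneg)
  finally show ?thesis by simp
qed

lemma normalized_in_disk_boundary:
  assumes "z \<in> topspace (disk n)" "disk_radius n z > 0"
  shows "(\<lambda>i. z i / disk_radius n z) \<in> topspace (disk_boundary n)"
  using assms disk_radius_divide[OF assms(2)] unfolding topspace_disk topspace_disk_boundary by simp

lemma continuous_map_disk_coordinate: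
  "continuous_map (disk n) euclideanreal (\<lambda>z. z i)"
  unfolding disk_def Euclidean_space_def
  by (intro continuous_map_from_subtopology continuous_map_product_coordinates) simp

lemma cone_peak_bounds:
  assumes G: "G \<in> topspace (disk_boundary n) \<times> {0..1} \<rightarrow> {0..1}"
    and z: "z \<in> topspace (disk n)" and t: "t \<in> {0..1}"
  shows "cone_peak n G (z, t) \<in> {0..1}"
proof -
  let ?r = "disk_radius n z"
  have r: "0 \<le> ?r" "?r \<le> 1" using z by (auto simp: topspace_disk sum_nonneg)
  have "min 1 (2 * ?r) * G (\<lambda>i. z i / ?r, t) \<in> {0..1}"
  proof (cases "?r = 0")
    case False
    then have "G (\<lambda>i. z i / ?r, t) \<in> {0..1}"
      using r t normalized_in_disk_boundary[OF z] by (intro funcset_mem[OF G]) simp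
    then show ?thesis
      using r by (auto intro!: mult_le_one)
  qed simp
  moreover have "min 1 (2 - 2 * ?r) * (1 - \<bar>2 * t - 1\<bar>) \<in> {0..1}"
    using r t by (auto intro!: mult_le_one mult_nonneg_nonneg)
  ultimately show ?thesis
    by (auto simp: cone_peak_def max_def)
qed

text \<open>Continuity is tested along a path \<open>s \<mapsto> (z s, \<tau> s)\<close> in the product. Where the radius of \<open>z s\<close> is
  positive, the normalised point moves continuously on the sphere and \<open>continuous_on_local_path\<close>
  applies. Where it is zero, the term with \<open>G\<close> is squeezed to 0, because \<open>G\<close> is bounded by 1.\<close>

lemma continuous_map_cone_peak:
  assumes G: "continuous_map (kelleyfication (prod_topology (disk_boundary n) I01)) I01 G"
  shows "continuous_map (kelleyfication (prod_topology (disk n) I01)) I01 (cone_peak n G)"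
proof (rule continuous_map_from_kelleyfication)
  fix c assume c: "continuous_map I01 (prod_topology (disk n) I01) c"
  have G01: "G \<in> topspace (disk_boundary n) \<times> {0..1} \<rightarrow> {0..1}"
    using continuous_map_funspace[OF G] by simp
  define z where "z s = fst (c s)" for s
  define \<tau> where "\<tau> s = snd (c s)" for s
  define r where "r s = disk_radius n (z s)" for s
  have cz: "continuous_map I01 (disk n) z" and c\<tau>: "continuous_map I01 I01 \<tau>"
    using c by (simp_all add: continuous_map_pairwise o_def z_def[abs_def] \<tau>_def[abs_def])
  have z: "z s \<in> topspace (disk n)" and \<tau>: "\<tau> s \<in> {0..1}" if "s \<in> {0..1}" for s
    using that funcset_mem[OF continuous_map_funspace[OF cz], of s]
      funcset_mem[OF continuous_map_funspace[OF c\<tau>], of s] by simp_all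
  have zi: "continuous_on {0..1} (\<lambda>s. z s i)" for i
    using continuous_map_compose[OF cz continuous_map_disk_coordinate[of n i]] by (simp add: o_def)
  then have cr: "continuous_on {0..1} r"
    unfolding r_def by (intro continuous_intros)
  have c\<tau>': "continuous_on {0..1} \<tau>" using c\<tau> by simp
  define S where "S = {s \<in> {0..1}. r s > 0}"
  have S: "openin I01 S"
    using openin_continuous_map_preimage[of I01 euclideanreal r "{0<..}"] cr by (simp add: S_def)
  have S01: "S \<subseteq> {0..1}" by (auto simp: S_def)
  define q where "q s = ((\<lambda>i. z s i / r s), \<tau> s)" for s
  have q_mem: "fst (q s) \<in> topspace (disk_boundary n)" if "s \<in> S" for s
    using normalized_in_disk_boundary[OF z, of s] that by (simp add: q_def r_def S_def)
  have "continuous_on S (\<lambda>s. z s i / r s)" for i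
    using continuous_on_subset[OF zi S01] continuous_on_subset[OF cr S01]
    by (intro continuous_intros) (auto simp: S_def)
  then have "continuous_map (top_of_set S) (disk_boundary n) (\<lambda>s. fst (q s))"
    using q_mem unfolding topspace_disk_boundary
    by (auto simp: disk_boundary_def Euclidean_space_def continuous_map_in_subtopology
          continuous_map_componentwise_UNIV q_def)
  moreover have "continuous_map (top_of_set S) I01 (\<lambda>s. snd (q s))"
    using continuous_on_subset[OF c\<tau>' S01] \<tau> S01 by (auto simp: q_def)
  ultimately have "continuous_map (top_of_set S) (prod_topology (disk_boundary n) I01) q"
    by (simp add: continuous_map_pairwise o_def)
  then have Gq: "continuous_on S (G \<circ> q)"
    using S G by (intro continuous_on_local_path) (auto simp: continuous_map_in_subtopology)
  have main: "continuous_on {0..1} (\<lambda>s. min 1 (2 * r s) * G (q s))"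
    unfolding continuous_on_eq_continuous_within
  proof
    fix s :: real assume s: "s \<in> {0..1}"
    show "continuous (at s within {0..1}) (\<lambda>s. min 1 (2 * r s) * G (q s))"
    proof (cases "r s = 0")
      case False
      then have "s \<in> S"
        using s disk_radius_nonneg[of "z s" n] by (simp add: S_def r_def)
      moreover have "continuous_on S (\<lambda>s. min 1 (2 * r s) * G (q s))"
        using Gq continuous_on_subset[OF cr S01] by (intro continuous_intros) (auto simp: o_def)
      ultimately have "continuous (at s within S) (\<lambda>s. min 1 (2 * r s) * G (q s))"
        by (simp add: continuous_on_eq_continuous_within)
      moreover obtain V where "open V" "S = {0..1} \<inter> V"
        using S by (auto simp: openin_open)
      ultimately show ?thesis
        using \<open>s \<in> S\<close> at_within_nhd[of s V "{0..1}" S] by auto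
    next
      case True
      have "((\<lambda>s. min 1 (2 * r s) * G (q s)) \<longlongrightarrow> 0) (at s within {0..1})"
      proof (rule Lim_null_comparison)
        show "\<forall>\<^sub>F x in at s within {0..1}. norm (min 1 (2 * r x) * G (q x)) \<le> 2 * r x"
          unfolding eventually_at_filter
        proof (intro always_eventually allI impI)
          fix x :: real assume x: "x \<in> {0..1}"
          show "norm (min 1 (2 * r x) * G (q x)) \<le> 2 * r x"
          proof (cases "r x = 0")
            case False
            then have "x \<in> S"
              using x disk_radius_nonneg[of "z x" n] by (simp add: S_def r_def)
            then have "G (q x) \<in> {0..1}" "r x > 0"
              using funcset_mem[OF G01, of "q x"] q_mem[of x] \<tau>[OF x]
              by (auto simp: q_def S_def)
            then have "min 1 (2 * r x) * G (q x) \<le> (2 * r x) * 1" "0 \<le> min 1 (2 * r x) * G (q x)"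
              by (intro mult_mono mult_nonneg_nonneg; simp)+
            then show ?thesis by simp
          qed simp
        qed
        have "(r \<longlongrightarrow> r s) (at s within {0..1})"
          using cr s by (simp add: continuous_on_def)
        then show "((\<lambda>x. 2 * r x) \<longlongrightarrow> 0) (at s within {0..1})"
          using True tendsto_mult_right_zero by force
      qed
      then show ?thesis
        using True by (simp add: continuous_within)
    qed
  qed
  have "continuous_on {0..1} (\<lambda>s. max (min 1 (2 * r s) * G (q s)) (min 1 (2 - 2 * r s) * (1 - \<bar>2 * \<tau> s - 1\<bar>)))"
    by (intro continuous_intros main cr c\<tau>')
  moreover have eq: "(cone_peak n G \<circ> c) s = max (min 1 (2 * r s) * G (q s)) (min 1 (2 - 2 * r s) * (1 - \<bar>2 * \<tau> s - 1\<bar>))" for s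
    by (simp add: cone_peak_def q_def r_def z_def \<tau>_def split: prod.split)
  ultimately have "continuous_on {0..1} (cone_peak n G \<circ> c)"
    by (simp only: eq cong: continuous_on_cong)
  moreover have "(cone_peak n G \<circ> c) s \<in> {0..1}" if "s \<in> {0..1}" for s
    using cone_peak_bounds[OF G01 z[OF that] \<tau>[OF that]] by (simp add: z_def \<tau>_def)
  ultimately show "continuous_map I01 I01 (cone_peak n G \<circ> c)"
    by (auto simp: continuous_map_in_subtopology)
qed

lemma Glob_wellformed:
  assumes P: "P \<subseteq> reparam_M"
  shows "states (Glob P Z) \<subseteq> points (Glob P Z)"
    and "expaths (Glob P Z) \<subseteq> cmaps I01 (carrier_space (Glob P Z))"
    and "\<gamma> \<in> expaths (Glob P Z) \<Longrightarrow> \<gamma> 0 \<in> states (Glob P Z) \<and> \<gamma> 1 \<in> states (Glob P Z)"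
proof -
  show "states (Glob P Z) \<subseteq> points (Glob P Z)"
    by (simp add: Glob_def topspace_glob_space)
  show "expaths (Glob P Z) \<subseteq> cmaps I01 (carrier_space (Glob P Z))"
  proof
    fix \<gamma> assume "\<gamma> \<in> expaths (Glob P Z)"
    then obtain z \<phi> where g: "\<gamma> = compose {0..1} (glob_path z) \<phi>" "z \<in> topspace Z" "\<phi> \<in> P"
      by (auto simp: Glob_def)
    have \<phi>: "continuous_on {0..1} \<phi>" "\<phi> ` {0..1} = {0..1}"
      using reparam_M_properties[of \<phi>] g(3) P by auto
    then have r: "\<phi> t \<in> {0..1}" if "t \<in> {0..1}" for t
      using that by blast
    have "continuous_map I01 (prod_topology Z I01) (\<lambda>t. (z, \<phi> t))"
      using \<phi> g(2) by (auto simp: continuous_map_paired continuous_map_in_subtopology)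
    then have "continuous_map I01 (glob_space Z) (glob_pt \<circ> (\<lambda>t. (z, \<phi> t)))"
      by (intro continuous_map_compose[OF path_into_kelleyfication continuous_map_glob_pt])
    then have "continuous_map I01 (glob_space Z) \<gamma>"
      by (rule continuous_map_eq) (use r in \<open>simp add: g(1) compose_def glob_path_def\<close>)
    then show "\<gamma> \<in> cmaps I01 (carrier_space (Glob P Z))"
      by (simp add: cmaps_def Glob_def g(1) compose_def)
  qed
  assume "\<gamma> \<in> expaths (Glob P Z)"
  then obtain z \<phi> where g: "\<gamma> = compose {0..1} (glob_path z) \<phi>" "\<phi> \<in> P"
    by (auto simp: Glob_def)
  moreover have "\<phi> 0 = 0" "\<phi> 1 = 1"
    using reparam_M_properties[of \<phi>] g(2) P by auto
  ultimately show "\<gamma> 0 \<in> states (Glob P Z) \<and> \<gamma> 1 \<in> states (Glob P Z)"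
    by (simp add: Glob_def compose_def glob_path_def glob_pt_def)
qed

text \<open>The peak function restricted to the globe of the sphere is a family of loops, to which the
  contraction of \<open>cone_peak\<close> applies. On an execution path over \<open>z\<close> the value 1 is reached where
  the loop over \<open>z/r\<close> reaches it if \<open>r \<ge> 1/2\<close>, and at the middle of the tent otherwise. In
  dimension 0 the sphere is empty and the extension is the tent.\<close>

lemma peak_function_extends_over_globe:
  assumes P: "P \<subseteq> reparam_M"
    and h: "peak_function (Glob P (disk_boundary n)) h"
  obtains h' where "peak_function (Glob P (disk n)) h'"
    and "\<And>x. x \<in> points (Glob P (disk_boundary n)) \<Longrightarrow> h' x = h x"
proof -
  define G where "G = h \<circ> glob_pt"
  have h': "continuous_map (glob_space (disk_boundary n)) I01 h" "h Bot = 0" "h Top = 0"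
    using h by (auto simp: peak_function_def Glob_def)
  have G: "continuous_map (kelleyfication (prod_topology (disk_boundary n) I01)) I01 G"
    unfolding G_def using continuous_map_glob_pt h'(1) by (rule continuous_map_compose)
  have G01: "G \<in> topspace (disk_boundary n) \<times> {0..1} \<rightarrow> {0..1}"
    using continuous_map_funspace[OF G] by simp
  define k where "k x = (case x of Bot \<Rightarrow> 0 | Top \<Rightarrow> 0 | Mid z t \<Rightarrow> cone_peak n G (z, t))" for x
  have k: "k (glob_pt (z, t)) = cone_peak n G (z, t)" for z t
    by (simp add: k_def glob_pt_def cone_peak_def G_def h' max_def)
  have "k (glob_pt y) = cone_peak n G y" for y
    using k by (cases y) simp
  then have "k \<circ> glob_pt = cone_peak n G"
    by (simp add: fun_eq_iff)
  then have "continuous_map (glob_space (disk n)) I01 k"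
    using continuous_map_cone_peak[OF G]
    by (intro continuous_map_from_glob_space) (simp_all add: k_def)
  moreover have "\<exists>s\<in>{0..1}. k (\<gamma> s) = 1" if \<gamma>: "\<gamma> \<in> expaths (Glob P (disk n))" for \<gamma>
  proof -
    obtain z \<phi> where g: "\<gamma> = compose {0..1} (glob_path z) \<phi>" "z \<in> topspace (disk n)" "\<phi> \<in> P"
      using \<gamma> by (auto simp: Glob_def)
    have \<phi>: "\<phi> ` {0..1} = {0..1}"
      using reparam_M_properties[of \<phi>] g(3) P by auto
    have \<gamma>: "k (\<gamma> s) = cone_peak n G (z, \<phi> s)" if "s \<in> {0..1}" for s
    proof -
      have "\<phi> s \<in> {0..1}" using \<phi> that by blast
      then show ?thesis
        using that by (simp add: g(1) compose_def glob_path_def k)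
    qed
    let ?r = "disk_radius n z"
    show ?thesis
    proof (cases "1/2 \<le> ?r")
      case True
      let ?z = "\<lambda>i. z i / ?r"
      have z: "?z \<in> topspace (disk_boundary n)"
        using True by (intro normalized_in_disk_boundary g(2)) linarith
      then have "compose {0..1} (glob_path ?z) \<phi> \<in> expaths (Glob P (disk_boundary n))"
        using g(3) unfolding Glob_def by auto
      then obtain s where s: "s \<in> {0..1}" "h (compose {0..1} (glob_path ?z) \<phi> s) = 1"
        using h unfolding peak_function_def by blast
      have \<phi>s: "\<phi> s \<in> {0..1}" using \<phi> s(1) by blast
      then have "G (?z, \<phi> s) = 1"
        using s by (simp add: compose_def glob_path_def G_def)
      moreover have "min 1 (2 * ?r) = 1"
        using True by simp
      ultimately have "1 \<le> cone_peak n G (z, \<phi> s)"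
        unfolding cone_peak_def by simp
      then have "k (\<gamma> s) = 1"
        using \<gamma>[OF s(1)] cone_peak_bounds[OF G01 g(2) \<phi>s] by simp
      with s(1) show ?thesis by blast
    next
      case False
      have "1/2 \<in> \<phi> ` {0..1}" unfolding \<phi> by simp
      then obtain s where s: "s \<in> {0..1}" "\<phi> s = 1/2" by auto
      have "min 1 (2 - 2 * ?r) = 1"
        using False by simp
      then have "1 \<le> cone_peak n G (z, \<phi> s)"
        unfolding cone_peak_def by (simp add: s(2))
      moreover have "cone_peak n G (z, \<phi> s) \<in> {0..1}"
        by (rule cone_peak_bounds[OF G01 g(2)]) (simp add: s(2))
      ultimately have "k (\<gamma> s) = 1"
        using \<gamma>[OF s(1)] by simp
      with s(1) show ?thesis by blast
    qed
  qed
  ultimately have "peak_function (Glob P (disk n)) k"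
    unfolding peak_function_def by (auto simp: Glob_def k_def)
  moreover have "k x = h x" if x: "x \<in> points (Glob P (disk_boundary n))" for x
  proof -
    consider "x = Bot" | "x = Top"
      | z t where "x = glob_pt (z, t)" "z \<in> topspace (disk_boundary n)" "t \<in> {0..1}"
      using x by (auto simp: Glob_def topspace_glob_space)
    then show ?thesis
    proof cases
      case 3
      have r: "disk_radius n z = 1"
        using 3(2) by (simp add: topspace_disk_boundary)
      have "cone_peak n G (z, t) = G (z, t)"
        using funcset_mem[OF G01, of "(z, t)"] 3(2,3) unfolding cone_peak_def case_prod_conv r by simp
      then show ?thesis
        unfolding 3(1) k by (simp add: G_def)
    qed (simp_all add: k_def h')
  qed
  ultimately show ?thesis
    using that by blast
qed

section \<open>Transfinite construction of a peak function\<close>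

lemma index_cases:
  fixes \<nu> :: "'i::wellorder"
  obtains (zero) "\<nu> = index_zero"
    | (succ) \<mu> where "\<mu> < \<nu>" "\<nu> = index_succ \<mu>"
    | (limit) "index_limit \<nu>"
proof (cases "\<exists>\<mu>. \<mu> < \<nu>")
  case False
  then have "\<nu> = index_zero"
    unfolding index_zero_def by (intro Least_equality[symmetric]) (auto simp: not_less)
  then show ?thesis by (rule zero)
next
  case True
  have le: "index_succ \<mu> \<le> \<nu>" if "\<mu> < \<nu>" for \<mu>
    unfolding index_succ_def using that by (rule Least_le)
  show ?thesis
  proof (cases "\<exists>\<mu><\<nu>. \<nu> = index_succ \<mu>")
    case True
    then show ?thesis using succ by blast
  next
    case False
    then have "index_succ \<mu> < \<nu>" if "\<mu> < \<nu>" for \<mu>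
      using le[OF that] that by (auto simp: less_le)
    then show ?thesis
      using True limit unfolding index_limit_def by blast
  qed
qed

lemma index_succ_bounds:
  fixes \<mu> \<nu> :: "'i::wellorder"
  assumes "\<mu> < \<nu>"
  shows "\<mu> < index_succ \<mu>" "index_succ \<mu> \<le> \<nu>" "\<kappa> < index_succ \<mu> \<Longrightarrow> \<kappa> \<le> \<mu>"
proof -
  show "\<mu> < index_succ \<mu>" "index_succ \<mu> \<le> \<nu>"
    unfolding index_succ_def using assms by (auto intro: LeastI Least_le)
  show "\<kappa> \<le> \<mu>" if "\<kappa> < index_succ \<mu>"
    using that not_less_Least[of \<kappa> "\<lambda>x. \<mu> < x"] unfolding index_succ_def by (simp add: not_less)
qed

lemma md_hom_into_peak_space_retract:
  assumes e: "inj e" and v: "v \<in> md_hom X (peak_space e)" and x: "x \<in> points X"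
  shows "e (inv e (v x)) = v x"
proof -
  have "v x \<in> points (peak_space e)"
    using v x continuous_map_funspace by (fastforce simp: md_hom_def cmaps_def)
  then show ?thesis
    using e by (auto simp: points_peak_space)
qed

text \<open>By the universal property of the pushout it is enough to extend the composite of \<open>v\<close> with the
  attaching map from the globe of the sphere to the globe of the disk.\<close>

lemma peak_hom_extends_over_cell:
  fixes e :: "real \<Rightarrow> 't"
  assumes e: "inj e" and P: "P \<subseteq> reparam_M"
    and po: "is_pushout TYPE('t) T P (Glob P (disk_boundary n)) (Glob P (disk n)) X Y
               (glob_incl n) g k j"
    and v: "v \<in> md_hom X (peak_space e)"
  obtains w where "w \<in> md_hom Y (peak_space e)" "compose (points X) w j = v"
proof -
  let ?A = "Glob P (disk_boundary n)" and ?B = "Glob P (disk n)"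
  have g: "g \<in> md_hom ?A X" and i: "glob_incl n \<in> md_hom ?A ?B"
    using po by (auto simp: is_pushout_def)
  have "peak_function ?A (inv e \<circ> v \<circ> g)"
    using peak_function_of_hom[OF e v] g by (rule peak_function_compose)
  then obtain h' where h': "peak_function ?B h'" "\<And>x. x \<in> points ?A \<Longrightarrow> h' x = (inv e \<circ> v \<circ> g) x"
    using peak_function_extends_over_globe[OF P] by blast
  let ?u = "\<lambda>x\<in>points ?B. e (h' x)"
  have u: "?u \<in> md_hom ?B (peak_space e)"
    by (rule hom_of_peak_function[OF e h'(1) Glob_wellformed[OF P]])
  have "compose (points ?A) ?u (glob_incl n) = compose (points ?A) v g"
  proof
    fix x
    show "compose (points ?A) ?u (glob_incl n) x = compose (points ?A) v g x"
    proof (cases "x \<in> points ?A")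
      case True
      then have inc: "glob_incl n x = x"
        by (simp add: glob_incl_def Glob_def)
      moreover have "glob_incl n x \<in> points ?B"
        using i True by (auto simp: md_hom_def cmaps_def dest!: continuous_map_funspace)
      moreover have "g x \<in> points X"
        using g True by (auto simp: md_hom_def cmaps_def dest!: continuous_map_funspace)
      ultimately show ?thesis
        using True h'(2)[OF True] md_hom_into_peak_space_retract[OF e v]
        by (simp add: compose_def)
    qed (simp add: compose_def)
  qed
  then have "\<exists>!w. w \<in> md_hom Y (peak_space e) \<and> compose (points ?B) w k = ?u \<and> compose (points X) w j = v"
    using po is_mdspace_peak_space[OF e P] u v unfolding is_pushout_def by blast
  then show ?thesis
    using that by blast
qed

text \<open>Extensions over a cell are not unique, so the maps on the stages are chosen by well-founded
  recursion, each of them subject to extending all earlier ones. This compatibility is what the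
  colimit at a limit stage requires.\<close>

lemma cellular_has_peak_function:
  fixes C :: "('i::wellorder, 'a) tower"
  assumes P: "P \<subseteq> reparam_M" and C: "is_cellular T P C"
  obtains h where "peak_function (last_stage C) h"
proof -
  \<comment> \<open>any injection of the reals into the test type would do\<close>
  define e :: "real \<Rightarrow> ('i \<times> 'a) + (nat \<Rightarrow> real) glob" where "e t = Inr (Mid (\<lambda>_. 0) t)" for t
  have e: "inj e" by (auto simp: e_def inj_def)
  let ?E = "peak_space e" and ?pt = "\<lambda>\<nu>. points (stage C \<nu>)"
  have E: "is_mdspace T P ?E" by (rule is_mdspace_peak_space[OF e P])
  have seq: "is_transfinite_sequence T P C" using C by (simp add: is_cellular_def)
  define Q where "Q f \<nu> r \<longleftrightarrow> (\<nu> \<le> top_index C \<longrightarrow> r \<in> md_hom (stage C \<nu>) ?E \<and>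
      (\<forall>\<mu><\<nu>. compose (?pt \<mu>) r (transition C \<mu> \<nu>) = f \<mu>))" for f \<nu> r
  have "\<exists>f. \<forall>\<nu>. Q f \<nu> (f \<nu>)"
  proof (rule dependent_wellorder_choice)
    show "Q f \<nu> r = Q g \<nu> r" if "\<And>\<mu>. \<mu> < \<nu> \<Longrightarrow> f \<mu> = g \<mu>" for r f g \<nu>
      using that by (simp add: Q_def)
    fix \<nu> f assume IH: "\<And>\<mu>. \<mu> < \<nu> \<Longrightarrow> Q f \<mu> (f \<mu>)"
    have "\<exists>r. r \<in> md_hom (stage C \<nu>) ?E \<and> (\<forall>\<mu><\<nu>. compose (?pt \<mu>) r (transition C \<mu> \<nu>) = f \<mu>)"
      if \<nu>: "\<nu> \<le> top_index C"
    proof -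
      have hom: "f \<mu> \<in> md_hom (stage C \<mu>) ?E" if "\<mu> < \<nu>" for \<mu>
        using IH[OF that] that \<nu> by (simp add: Q_def)
      have coh: "compose (?pt \<mu>) (f \<rho>) (transition C \<mu> \<rho>) = f \<mu>" if "\<rho> < \<nu>" "\<mu> \<le> \<rho>" for \<mu> \<rho>
      proof (cases "\<mu> = \<rho>")
        case True
        have "transition C \<rho> \<rho> = (\<lambda>x\<in>?pt \<rho>. x)"
          using seq that \<nu> unfolding is_transfinite_sequence_def by (meson le_less_trans less_imp_le order_trans)
        moreover have "f \<rho> \<in> extensional (?pt \<rho>)"
          using hom[OF that(1)] by (simp add: md_hom_def cmaps_def)
        ultimately show ?thesis
          unfolding True by (auto simp: compose_def extensional_def restrict_def fun_eq_iff)
      next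
        case False
        then have "\<mu> < \<rho>" using that(2) by simp
        then show ?thesis
          using IH[OF that(1)] that(1) \<nu> by (simp add: Q_def)
      qed
      show ?thesis
      proof (cases \<nu> rule: index_cases)
        case zero
        obtain S where S: "stage C \<nu> = discrete_mdspace S"
          using C zero by (auto simp: is_cellular_def)
        have "peak_function (stage C \<nu>) (\<lambda>_. 0)"
          by (simp add: S peak_function_def discrete_mdspace_def)
        moreover have "is_mdspace T P (stage C \<nu>)"
          using seq \<nu> by (simp add: is_transfinite_sequence_def)
        ultimately have "(\<lambda>x\<in>?pt \<nu>. e 0) \<in> md_hom (stage C \<nu>) ?E"
          using hom_of_peak_function[OF e] by (fastforce simp: is_mdspace_def)
        moreover have "\<not> \<mu> < \<nu>" for \<mu>
          unfolding zero index_zero_def not_less by (rule Least_le) simp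
        ultimately show ?thesis by blast
      next
        case (succ \<mu>)
        have \<mu>: "\<mu> < top_index C" using succ(1) \<nu> by simp
        then have "is_pushout TYPE(('i \<times> 'a) + (nat \<Rightarrow> real) glob) T P
          (Glob P (disk_boundary (cell_dim C \<mu>))) (Glob P (disk (cell_dim C \<mu>)))
          (stage C \<mu>) (stage C \<nu>)
          (glob_incl (cell_dim C \<mu>)) (attach C \<mu>) (char_map C \<mu>) (transition C \<mu> \<nu>)"
          using C unfolding is_cellular_def succ(2) by blast
        then obtain w where w: "w \<in> md_hom (stage C \<nu>) ?E" "compose (?pt \<mu>) w (transition C \<mu> \<nu>) = f \<mu>"
          using peak_hom_extends_over_cell[OF e P _ hom[OF succ(1)]] by blast
        have "compose (?pt \<kappa>) w (transition C \<kappa> \<nu>) = f \<kappa>" if "\<kappa> < \<nu>" for \<kappa>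
        proof -
          have \<kappa>: "\<kappa> \<le> \<mu>"
            using that index_succ_bounds(3)[OF succ(1)] succ(2) by simp
          have tr: "compose (?pt \<kappa>) (transition C \<mu> \<nu>) (transition C \<kappa> \<mu>) = transition C \<kappa> \<nu>"
            using seq \<nu> \<kappa> succ(1) unfolding is_transfinite_sequence_def by (meson less_imp_le)
          have "transition C \<kappa> \<mu> \<in> md_hom (stage C \<kappa>) (stage C \<mu>)"
            using seq \<mu> \<kappa> unfolding is_transfinite_sequence_def by (meson less_imp_le)
          then have m: "transition C \<kappa> \<mu> x \<in> ?pt \<mu>" if "x \<in> ?pt \<kappa>" for x
            using that by (auto simp: md_hom_def cmaps_def dest!: continuous_map_funspace)
          have "compose (?pt \<kappa>) w (transition C \<kappa> \<nu>)
              = compose (?pt \<kappa>) (compose (?pt \<mu>) w (transition C \<mu> \<nu>)) (transition C \<kappa> \<mu>)"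
            unfolding tr[symmetric] using m by (auto simp: compose_def fun_eq_iff)
          also have "\<dots> = f \<kappa>"
            unfolding w(2) by (rule coh[OF succ(1) \<kappa>])
          finally show ?thesis .
        qed
        with w(1) show ?thesis by blast
      next
        case limit
        then have "is_seq_colimit TYPE(('i \<times> 'a) + (nat \<Rightarrow> real) glob) T P (stage C) (transition C) \<nu>"
          using C \<nu> by (simp add: is_cellular_def)
        note colimit = this[unfolded is_seq_colimit_def, THEN spec, THEN mp, OF E, THEN spec, THEN mp, THEN mp]
        have "\<exists>!w. w \<in> md_hom (stage C \<nu>) ?E \<and> (\<forall>\<mu><\<nu>. compose (?pt \<mu>) w (transition C \<mu> \<nu>) = f \<mu>)"
          by (rule colimit) (simp_all add: hom coh)
        then show ?thesis by blast
      qed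
    qed
    then show "\<exists>r. Q f \<nu> r"
      unfolding Q_def by blast
  qed
  then obtain f where "Q f (top_index C) (f (top_index C))" by blast
  then have "f (top_index C) \<in> md_hom (last_stage C) ?E"
    by (simp add: Q_def last_stage_def)
  then show ?thesis
    using peak_function_of_hom[OF e] that by blast
qed

section \<open>Evaluation of a continuous family of paths\<close>

text \<open>Around a parameter \<open>t\<close>, the path \<open>\<psi> u\<close> sends a whole compact interval into the preimage of the
  given open set, and this is an open condition on the path in the compact-open topology.\<close>

lemma compact_open_evaluation_continuous:
  fixes f :: "'b \<Rightarrow> real" and S :: "real set"
  assumes \<psi>: "continuous_map (top_of_set S) (compact_open I01 Y) \<psi>"
    and f: "continuous_map Y euclideanreal f"
  shows "continuous_on (S \<times> {0..1}) (\<lambda>(u, t). f (\<psi> u t))"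
  unfolding continuous_on_topological
proof (intro ballI allI impI)
  fix x B assume x: "x \<in> S \<times> {0..1}" and B: "open B" "(\<lambda>(u, t). f (\<psi> u t)) x \<in> B"
  obtain u t where ut: "x = (u, t)" "u \<in> S" "t \<in> {0..1}" using x by auto
  have "topspace (compact_open I01 Y) \<subseteq> cmaps I01 Y"
    by (auto simp: compact_open_def)
  then have cm: "\<psi> v \<in> cmaps I01 Y" if "v \<in> S" for v
    using that funcset_mem[OF continuous_map_funspace[OF \<psi>], of v] by auto
  then have "continuous_on {0..1} (f \<circ> \<psi> u)"
    using continuous_map_compose[of I01 Y "\<psi> u" euclideanreal f] f ut(2) by (simp add: cmaps_def)
  then obtain A where A: "open A" "t \<in> A" "\<And>s. s \<in> {0..1} \<Longrightarrow> s \<in> A \<Longrightarrow> f (\<psi> u s) \<in> B"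
    using B ut unfolding continuous_on_topological o_def by (metis case_prod_conv)
  then obtain e where e: "e > 0" "cball t e \<subseteq> A"
    by (meson open_contains_cball)
  define K where "K = {0..1} \<inter> cball t e"
  have K: "compactin I01 K"
    by (simp add: K_def compactin_subtopology compact_Int)
  define W where "W = {y \<in> topspace Y. f y \<in> B}"
  have W: "openin Y W"
    using f B(1) by (auto simp: W_def intro: openin_continuous_map_preimage)
  define N where "N = {g \<in> cmaps I01 Y. g ` K \<subseteq> W}"
  have "openin (compact_open I01 Y) N"
    unfolding compact_open_def N_def using K W by (intro topology_generated_by_Basis) blast
  then have "openin (top_of_set S) {v \<in> S. \<psi> v \<in> N}"
    using openin_continuous_map_preimage[OF \<psi>] by simp
  then obtain V where V: "open V" "{v \<in> S. \<psi> v \<in> N} = S \<inter> V"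
    by (metis openin_open)
  have "\<psi> u s \<in> W" if "s \<in> K" for s
  proof -
    have "\<psi> u s \<in> topspace Y"
      using cm[OF ut(2)] that by (auto simp: cmaps_def K_def dest!: continuous_map_funspace)
    then show ?thesis
      using that e(2) A(3) by (auto simp: W_def K_def)
  qed
  then have "u \<in> V"
    using V(2) ut(2) cm by (auto simp: N_def)
  moreover have "f (\<psi> v s) \<in> B" if "v \<in> S" "v \<in> V" "s \<in> {0..1}" "s \<in> ball t e" for v s
  proof -
    have "\<psi> v \<in> N" using V(2) that by blast
    moreover have "s \<in> K" using that by (simp add: K_def)
    ultimately show ?thesis by (auto simp: N_def W_def)
  qed
  ultimately show "\<exists>A. open A \<and> x \<in> A \<and> (\<forall>y\<in>S \<times> {0..1}. y \<in> A \<longrightarrow> (\<lambda>(u, t). f (\<psi> u t)) y \<in> B)"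
    using V(1) e(1) ut by (intro exI[of _ "V \<times> ball t e"]) (auto intro: open_Times)
qed

lemma continuous_map_path_space_compact_open:
  assumes "continuous_map Z (path_space X \<alpha> \<beta>) \<psi>"
  shows "continuous_map Z (compact_open I01 (carrier_space X)) \<psi>"
  using assms unfolding path_space_def mapping_space_def
  by (blast dest: continuous_map_into_kelleyficationD continuous_map_into_fulltopology)

section \<open>The number of factors of a Moore composition\<close>

lemma fst_moore_concat:
  "ps \<noteq> [] \<Longrightarrow> fst (moore_concat ps) = sum_list (map fst ps)"
proof (induction ps rule: moore_concat.induct)
  case (3 p q ps)
  then show ?case
    by (cases p; cases "moore_concat (q # ps)") simp
qed auto

lemma fst_moore_concat_nonneg:
  assumes "ps \<noteq> []" "\<And>p. p \<in> set ps \<Longrightarrow> 0 \<le> fst p"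
  shows "0 \<le> fst (moore_concat ps)"
  unfolding fst_moore_concat[OF assms(1)] using assms(2) by (intro sum_list_nonneg) auto

lemma moore_concat_start:
  assumes "ps \<noteq> []" "\<And>p. p \<in> set ps \<Longrightarrow> 0 \<le> fst p"
  shows "snd (moore_concat ps) 0 = snd (hd ps) 0"
  using assms
proof (induction ps rule: moore_concat.induct)
  case (3 p q ps)
  have "0 \<le> fst (moore_concat (q # ps))"
    by (rule fst_moore_concat_nonneg) (use 3(3) in auto)
  moreover have "0 \<le> fst p" using 3(3)[of p] by simp
  ultimately show ?case
    by (cases p; cases "moore_concat (q # ps)") simp
qed auto

text \<open>Each factor climbs from height 0 at its start to height 1, which takes time at least \<open>\<delta>\<close> if
  the height varies by less than 1 over shorter times. The heights at both ends of a factor being 0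
  makes the modulus of continuity pass to the factors: at a junction it does not matter whether
  the point is read from the earlier or from the later factor.\<close>

lemma length_moore_concat_le:
  fixes f :: "'a \<Rightarrow> real" and \<delta> :: real
  assumes "ps \<noteq> []"
    and "\<And>p. p \<in> set ps \<Longrightarrow>
           0 \<le> fst p \<and> f (snd p 0) = 0 \<and> f (snd p (fst p)) = 0 \<and> (\<exists>t\<in>{0..fst p}. f (snd p t) = 1)"
    and "\<And>s t. s \<in> {0..fst (moore_concat ps)} \<Longrightarrow> t \<in> {0..fst (moore_concat ps)} \<Longrightarrow> \<bar>s - t\<bar> < \<delta> \<Longrightarrow>
           \<bar>f (snd (moore_concat ps) s) - f (snd (moore_concat ps) t)\<bar> < 1"
  shows "real (length ps) * \<delta> \<le> fst (moore_concat ps)"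
  using assms
proof (induction ps rule: moore_concat.induct)
  case (2 p)
  obtain t where "t \<in> {0..fst p}" "f (snd p t) = 1" "f (snd p 0) = 0"
    using 2(2)[of p] by auto
  then show ?case
    using 2(3)[of t 0] by force
next
  case (3 p q ps)
  obtain l1 p1 where p: "p = (l1, p1)" by (cases p)
  obtain l2 \<gamma> where \<gamma>: "moore_concat (q # ps) = (l2, \<gamma>)" by (cases "moore_concat (q # ps)")
  have p1: "0 \<le> l1" "f (p1 0) = 0" "f (p1 l1) = 0"
    using 3(3)[of p] p by auto
  obtain t where t: "t \<in> {0..l1}" "f (p1 t) = 1"
    using 3(3)[of p] p by auto
  have l2: "0 \<le> l2"
    using fst_moore_concat_nonneg[of "q # ps"] 3(3) \<gamma> by simp
  have "\<gamma> 0 = snd q 0"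
    using moore_concat_start[of "q # ps"] 3(3) \<gamma> by simp
  then have \<gamma>0: "f (\<gamma> 0) = 0"
    using 3(3)[of q] by simp
  define \<eta> where "\<eta> = snd (moore_concat (p # q # ps))"
  have \<eta>: "\<eta> s = (if s \<le> l1 then p1 s else \<gamma> (s - l1))" if "s \<in> {0..l1 + l2}" for s
    using that by (simp add: \<eta>_def p \<gamma>)
  have total: "fst (moore_concat (p # q # ps)) = l1 + l2"
    by (simp add: p \<gamma>)
  have modulus: "\<bar>f (\<eta> s) - f (\<eta> t)\<bar> < 1" if "s \<in> {0..l1 + l2}" "t \<in> {0..l1 + l2}" "\<bar>s - t\<bar> < \<delta>" for s t
    using 3(4)[of s t] that unfolding total \<eta>_def by blast
  have "\<delta> \<le> l1"
    using modulus[of t 0] \<eta>[of t] \<eta>[of 0] t p1 l2 by force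
  \<comment> \<open>for \<open>s = 0\<close> the right-hand side is read from \<open>p1\<close>, where the height is 0 as well\<close>
  have shift: "f (\<gamma> s) = f (\<eta> (s + l1))" if "s \<in> {0..l2}" for s
    using that \<eta>[of "s + l1"] p1 l2 \<gamma>0 by (cases "s = 0") auto
  have "real (length (q # ps)) * \<delta> \<le> fst (moore_concat (q # ps))"
  proof (rule 3(1))
    fix s t assume "s \<in> {0..fst (moore_concat (q # ps))}" "t \<in> {0..fst (moore_concat (q # ps))}" "\<bar>s - t\<bar> < \<delta>"
    then show "\<bar>f (snd (moore_concat (q # ps)) s) - f (snd (moore_concat (q # ps)) t)\<bar> < 1"
      using modulus[of "s + l1" "t + l1"] shift[of s] shift[of t] p1(1) by (simp add: \<gamma>)
  next
    fix c assume "c \<in> set (q # ps)"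
    then show "0 \<le> fst c \<and> f (snd c 0) = 0 \<and> f (snd c (fst c)) = 0 \<and> (\<exists>t\<in>{0..fst c}. f (snd c t) = 1)"
      by (intro 3(3)) simp
  qed simp
  then show ?case
    using \<open>\<delta> \<le> l1\<close> by (simp add: p \<gamma> algebra_simps)
qed simp

lemma cell_path_is_expath:
  assumes C: "is_cellular T P C" and \<nu>: "\<nu> < top_index C"
    and z: "z \<in> topspace (disk (cell_dim C \<nu>))" and \<phi>: "\<phi> \<in> P" "\<phi> ` {0..1} = {0..1}"
  obtains \<gamma> where "\<gamma> \<in> expaths (last_stage C)"
    and "\<And>s. s \<in> {0..1} \<Longrightarrow> \<gamma> s = cell_map P C \<nu> (glob_path z (\<phi> s))"
proof -
  let ?B = "Glob P (disk (cell_dim C \<nu>))"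
  let ?\<delta> = "compose {0..1} (glob_path z) \<phi>"
  let ?\<gamma> = "compose {0..1} (transition C (index_succ \<nu>) (top_index C)) (compose {0..1} (char_map C \<nu>) ?\<delta>)"
  have "?\<delta> \<in> expaths ?B"
    using z \<phi> by (auto simp: Glob_def)
  moreover have "char_map C \<nu> \<in> md_hom ?B (stage C (index_succ \<nu>))"
    using C \<nu> unfolding is_cellular_def is_pushout_def by blast
  moreover have "transition C (index_succ \<nu>) (top_index C) \<in> md_hom (stage C (index_succ \<nu>)) (last_stage C)"
    using C index_succ_bounds(2)[OF \<nu>]
    by (simp add: is_cellular_def is_transfinite_sequence_def last_stage_def)
  ultimately have "?\<gamma> \<in> expaths (last_stage C)"
    by (auto simp: md_hom_def)
  moreover have "?\<gamma> s = cell_map P C \<nu> (glob_path z (\<phi> s))" if "s \<in> {0..1}" for s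
  proof -
    have "\<phi> s \<in> {0..1}" using \<phi>(2) that by blast
    then have "glob_path z (\<phi> s) \<in> points ?B"
      using z by (simp add: Glob_def topspace_glob_space glob_path_def)
    then show ?thesis
      using that by (simp add: cell_map_def compose_def)
  qed
  ultimately show ?thesis
    using that by blast
qed

lemma length_natural_decomposition_le:
  fixes \<delta> :: real
  assumes P: "P \<subseteq> reparam_M" and C: "is_cellular T P C"
    and X: "is_mdspace T P (last_stage C)"
    and h: "peak_function (last_stage C) h"
    and ds: "is_natural_decomposition P C \<gamma> ds"
    and modulus: "\<And>s t. s \<in> {0..1} \<Longrightarrow> t \<in> {0..1} \<Longrightarrow> \<bar>s - t\<bar> < \<delta> \<Longrightarrow> \<bar>h (\<gamma> s) - h (\<gamma> t)\<bar> < 1"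
  shows "real (length ds) * \<delta> \<le> 1"
proof -
  let ?ps = "map (cell_segment P C) ds"
  have ne: "?ps \<noteq> []" and \<gamma>: "\<gamma> = snd (moore_concat ?ps)"
    using ds by (auto simp: is_natural_decomposition_def)
  have "map fst ?ps = map (\<lambda>(\<nu>, z, \<phi>, l). l) ds"
    by (auto simp: cell_segment_def)
  then have total: "fst (moore_concat ?ps) = 1"
    using ds fst_moore_concat[OF ne] by (simp only: is_natural_decomposition_def)
  have "real (length ?ps) * \<delta> \<le> fst (moore_concat ?ps)"
  proof (rule length_moore_concat_le[where f = h, OF ne])
    fix c assume "c \<in> set ?ps"
    then obtain \<nu> z \<phi> l p where c: "c = (l, p)" and d: "(\<nu>, z, \<phi>, l) \<in> set ds"
      and p: "p = (\<lambda>t\<in>{0..l}. cell_map P C \<nu> (glob_path z (\<phi> (t / l))))"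
      by (auto simp: cell_segment_def)
    have *: "\<nu> < top_index C" "z \<in> topspace (disk (cell_dim C \<nu>))" "\<phi> \<in> P" and l: "0 < l"
      using ds d by (auto simp: is_natural_decomposition_def)
    have "\<phi> ` {0..1} = {0..1}"
      using *(3) P reparam_M_properties(2) by blast
    then obtain \<eta> where \<eta>: "\<eta> \<in> expaths (last_stage C)"
      and \<eta>_eq: "\<And>s. s \<in> {0..1} \<Longrightarrow> \<eta> s = cell_map P C \<nu> (glob_path z (\<phi> s))"
      using cell_path_is_expath[OF C *] by blast
    have p\<eta>: "p (s * l) = \<eta> s" if "s \<in> {0..1}" for s
      using that l \<eta>_eq[OF that] by (simp add: p mult_le_cancel_right1 mult_left_le_one_le)
    have "\<eta> 0 \<in> states (last_stage C)" "\<eta> 1 \<in> states (last_stage C)"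
      using X \<eta> by (auto simp: is_mdspace_def)
    then have "h (\<eta> 0) = 0" "h (\<eta> 1) = 0"
      using h by (auto simp: peak_function_def)
    moreover obtain s where s: "s \<in> {0..1}" "h (\<eta> s) = 1"
      using h \<eta> by (auto simp: peak_function_def)
    have "s * l \<in> {0..l}"
      using s l by (simp add: mult_left_le_one_le)
    then have "\<exists>t\<in>{0..l}. h (p t) = 1"
      using p\<eta>[OF s(1)] s(2) by (intro bexI[of _ "s * l"]) simp_all
    ultimately show "0 \<le> fst c \<and> h (snd c 0) = 0 \<and> h (snd c (fst c)) = 0 \<and>
        (\<exists>t\<in>{0..fst c}. h (snd c t) = 1)"
      using p\<eta>[of 0] p\<eta>[of 1] l by (simp add: c)
  qed (use modulus in \<open>simp add: total flip: \<gamma>\<close>)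
  then show ?thesis
    by (simp add: total)
qed

section \<open>Boundedness of the natural lengths\<close>

text \<open>The value of a definite description depends only on the set of its candidates, even when it has no
  unique witness. If all these sets lie below \<open>B\<close>, there are finitely many of them. So a
  uniform bound on the lengths of all natural decompositions bounds the natural lengths.\<close>

lemma bdd_above_The_image:
  fixes A :: "'u \<Rightarrow> nat set"
  assumes "\<And>u. u \<in> U \<Longrightarrow> A u \<subseteq> {..B}"
  shows "bdd_above ((\<lambda>u. THE N. N \<in> A u) ` U)"
proof -
  have "(\<lambda>u. THE N. N \<in> A u) ` U \<subseteq> (\<lambda>S. THE N. N \<in> S) ` Pow {..B}"
    using assms by blast
  then have "finite ((\<lambda>u. THE N. N \<in> A u) ` U)"
    by (rule finite_subset) simp
  then show ?thesis
    by (rule bdd_above_finite)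
qed

theorem corollary4:
  fixes T :: top_category
    and P :: "(real \<Rightarrow> real) set"
    and C :: "('i::wellorder, 'a) tower"
    and \<alpha> \<beta> :: 'a
    and \<psi> :: "real \<Rightarrow> real \<Rightarrow> 'a"
  assumes "P = reparam_G \<or> P = reparam_M"
    and "is_cellular T P C"
    and "\<alpha> \<in> states (last_stage C)" and "\<beta> \<in> states (last_stage C)"
    and "continuous_map I01 (path_space (last_stage C) \<alpha> \<beta>) \<psi>"
  shows "bdd_above ((\<lambda>u. natural_length P C (\<psi> u)) ` {0..1})"
proof -
  have P: "P \<subseteq> reparam_M"
    using assms(1) reparam_G_subset_reparam_M by blast
  have X: "is_mdspace T P (last_stage C)"
    using assms(2) by (simp add: is_cellular_def is_transfinite_sequence_def last_stage_def)
  obtain h where h: "peak_function (last_stage C) h"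
    using cellular_has_peak_function[OF P assms(2)] .
  then have "continuous_map (carrier_space (last_stage C)) euclideanreal h"
    by (auto simp: peak_function_def continuous_map_in_subtopology)
  then have "continuous_on ({0..1} \<times> {0..1}) (\<lambda>(u, t). h (\<psi> u t))"
    using continuous_map_path_space_compact_open[OF assms(5)]
    by (intro compact_open_evaluation_continuous)
  then have "uniformly_continuous_on ({0..1} \<times> {0..1}) (\<lambda>(u, t). h (\<psi> u t))"
    by (intro compact_uniformly_continuous compact_Times) auto
  then obtain \<delta> where "\<delta> > 0" and \<delta>: "\<And>x y. x \<in> {0..1} \<times> {0..1} \<Longrightarrow> y \<in> {0..1} \<times> {0..1} \<Longrightarrow> dist y x < \<delta> \<Longrightarrow>
      dist ((\<lambda>(u, t). h (\<psi> u t)) y) ((\<lambda>(u, t). h (\<psi> u t)) x) < 1"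
    unfolding uniformly_continuous_on_def by (metis zero_less_one)
  have bound: "length ds \<le> nat \<lfloor>1 / \<delta>\<rfloor>"
    if u: "u \<in> {0..1}" and ds: "is_natural_decomposition P C (\<psi> u) ds" for u ds
  proof -
    have "real (length ds) * \<delta> \<le> 1"
    proof (rule length_natural_decomposition_le[OF P assms(2) X h ds])
      show "\<bar>h (\<psi> u s) - h (\<psi> u t)\<bar> < 1" if "s \<in> {0..1}" "t \<in> {0..1}" "\<bar>s - t\<bar> < \<delta>" for s t
        using \<delta>[of "(u, t)" "(u, s)"] u that by (simp add: dist_Pair_Pair dist_real_def)
    qed
    then show ?thesis
      using \<open>\<delta> > 0\<close> by (simp add: le_nat_floor field_simps)
  qed
  have "bdd_above ((\<lambda>u. THE N. N \<in> {N. \<exists>ds. is_natural_decomposition P C (\<psi> u) ds \<and> length ds = N}) ` {0..1})"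
    by (rule bdd_above_The_image[where B = "nat \<lfloor>1 / \<delta>\<rfloor>"]) (use bound in auto)
  then show ?thesis
    by (simp add: natural_length_def)
qed

end
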